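(* In the setting of the context, take $\widetilde c=\chi_2$. Then (with a suitable labelling inside the unordered pairs) the transformation of the parameters of the $q$-Painlevé VI equation induced by the $q$-middle convolution, rewritten in the variables $\kappa_i,\nu_j,f,g$, coincides with the action of $$s_5s_2s_1s_0s_2s_3s_2s_0s_1s_2\in W(D_5^{(1)}),$$ and it is given by $$\nu_1\to q\frac{\nu_1\nu_2\nu_5}{\kappa_2},\quad \nu_2\to\nu_2,\quad \frac{\kappa_1}{\nu_7}\to\frac{\kappa_1}{\nu_7},\quad\frac{\kappa_1}{\nu_8}\to\frac{\kappa_1}{\nu_8},\quad \nu_3\to q\frac{\nu_2\nu_3\nu_5}{\kappa_2},\quad \nu_4\to q\frac{\nu_2\nu_4\nu_5}{\kappa_2},$$ $$\frac{\kappa_2}{\nu_5}\to q\frac{\nu_2\nu_5}{\nu_6},\quad \frac{\kappa_2}{\nu_6}\to q^2\frac{\nu_2^2\nu_5}{\kappa_2},$$ $$f\to\widetilde f=\frac{\dfrac{(f-\nu_3)(f-\nu_4)}{(f-\kappa_1/\nu_7)(f-\kappa_1/\nu_8)}g-\dfrac1{\nu_1}}{\dfrac{(f-\nu_3)(f-\nu_4)}{(f-\kappa_1/\nu_7)(f-\kappa_1/\nu_8)}g-\dfrac{\kappa_2}{q\nu_1\nu_2\nu_5}}\,f,$$ $$g\to\widetilde g=\frac{(f-\nu_3)(f-\nu_4)}{(f-\kappa_1/\nu_7)(f-\kappa_1/\nu_8)}\cdot\frac{(\widetilde f-\kappa_1/\nu_7)(\widetilde f-\kappa_1/\nu_8)}{(\widetilde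 f-q\nu_2\nu_3\nu_5/\kappa_2)(\widetilde f-q\nu_2\nu_4\nu_5/\kappa_2)}\,g.$$
   Context: Parameters: $q,t,a_1,\dots,a_4,\chi_1,\chi_2,\theta_1,\theta_2,w,y,z$ are nonzero and generic with $\chi_1\chi_2a_1a_2a_3a_4=\theta_1\theta_2$. Parametrized linear system. Consider $2\times2$ matrices $A(x)=A_0+A_1x+A_2x^2$ such that $A_2=\mathrm{diag}(\chi_1,\chi_2)$, $A_0$ has eigenvalues $t\theta_1,t\theta_2$, $\det A(x)=\chi_1\chi_2(x-ta_1)(x-ta_2)(x-a_3)(x-a_4)$, the upper right entry is $a_{12}(x)=\chi_2w(x-y)$ and the upper left entry satisfies $a_{11}(y)=(y-ta_1)(y-ta_2)/(qz)$. These conditions determine $A(x)$ in terms of the parameters. Put $B(x)=\frac{ta_1a_2}{\theta_1}\frac{A(x)}{(x-ta_1)(x-ta_2)}=B_\infty+\frac{B_1}{1-x/(ta_1)}+\frac{B_2}{1-x/(ta_2)}$ and $B_0=I_2-B_\infty-B_1-B_2$; then $\det B_0=\det B_1=\det B_2=0$. $q$-middle convolution. Let $q^\lambda=\chi_2ta_1a_2/\theta_1$. Define $6\times6$ matrices ($2\times2$ blocks) $$F_1=\begin{pmatrix}O&O&O\\ B_0&B_1-(1-q^\lambda)I_2&B_2\\ O&O&O\end{pmatrix},\ F_2=\begin{pmatrix}O&O&O\\ O&O&O\\ B_0&B_1&B_2-(1-q^\lambda)I_2\end{pmatrix},\ \widehat F=\begin{pmatrix}B_0&B_1&B_2\\ B_0&B_1&B_2\\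 B_0&B_1&B_2\end{pmatrix},\ F_\infty=I_6-\widehat F,$$ and the invariant subspaces $\mathcal K=\ker B_0\oplus\ker B_1\oplus\ker B_2$, $\mathcal L=\ker(\widehat F-(1-q^\lambda)I_6)$ of $\mathbb C^6$. The actions of $F_\infty,F_1,F_2$ on the two-dimensional quotient $\mathbb C^6/(\mathcal K+\mathcal L)$, in a basis diagonalizing the action of $F_\infty$ as $\overline F_\infty=\mathrm{diag}(\chi_1ta_1a_2/\theta_1,\,1)$, are denoted $\overline F_\infty,\overline F_1,\overline F_2$. Explicitly one may take $$\overline F_1=\frac{a_1}{qyz\theta_1(a_1-a_2)(\theta_1-\chi_1ta_1a_2)}\begin{pmatrix}-(y-ta_1)f_1^{[1]}a_2^2&-f_2^{[1]}(y-ta_1)a_2\\ f_1^{[1]}f_3^{[1]}a_2&f_2^{[1]}f_3^{[1]}\end{pmatrix},$$ $f_1^{[1]}=q^2\chi_1^2\chi_2(y-a_3)(y-a_4)z^2+(y-ta_2)(y\chi_2-\chi_1ta_1)-q\chi_1\{2\chi_2y^2-(\chi_1ta_1+\chi_2ta_2+\chi_2a_3+\chi_2a_4)y+t(\theta_1+\theta_2)\}z$, $f_2^{[1]}=q\chi_1\chi_2a_2(y-a_3)(y-a_4)z-(y-ta_2)(a_2\chi_2y-\theta_1)$, $f_3^{[1]}=q(ya_2\chi_1-\theta_1)z-a_2(y-ta_1)$, and $\overline F_2=\overline F_1|_{a_1\leftrightarrow a_2}$. Set, for a nonzero constant $\widetilde c$, $$\widetilde A(x)=\widetilde c(x-ta_1)(x-ta_2)\Big(\overline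 F_\infty+\frac{\overline F_1}{1-x/(ta_1)}+\frac{\overline F_2}{1-x/(ta_2)}\Big).$$ The matrix $\widetilde A(x)$ is again of the same type as $A(x)$ (with the same $t$), and the induced transformation of parameters sends $\chi_1,\chi_2,\{a_1,a_2\},\{a_3,a_4\},\{t\theta_1,t\theta_2\},y,z$ to the corresponding parameters of $\widetilde A$: the diagonal entries of the $x^2$-coefficient, the zeros of $\det\widetilde A$ (with $ta_1,ta_2\mapsto ta_1,ta_2$), the eigenvalues of $\widetilde A(0)$, the zero $\widetilde y$ of the upper right entry of $\widetilde A$, and $\widetilde z$ defined by $\widetilde a_{11}(\widetilde y)=(\widetilde y-ta_1)(\widetilde y-ta_2)/(q\widetilde z)$. The labelling inside each unordered pair is a free choice. Change of variables: $g=qz$, $f=y$, $\nu_1=\chi_1$, $q\nu_2=\chi_2$, $\nu_5/\kappa_2=ta_1a_2/\theta_1$, $\nu_6/\kappa_2=ta_1a_2/\theta_2$, $\nu_3=a_3$, $\nu_4=a_4$, $\kappa_1/\nu_7=ta_1$, $\kappa_1/\nu_8=ta_2$; the constraint becomes $\kappa_1^2\kappa_2^2=q\nu_1\nu_2\nu_3\nu_4\nu_5\nu_6\nu_7\nu_8$. Affine Weyl group action. The generators $s_0,\dots,s_5$ of $W(D_5^{(1)})$ act as automorphisms of the field of rational functions in $\kappa_1,\kappa_2,\nu_1,\dots,\nu_8,f,g$ (subject to the constraint), variables not listed being fixed: $s_0:\nu_7\leftrightarrow\nu_8$; $s_1:\nu_3\leftrightarrow\nu_4$; $s_4:\nu_1\leftrightarrow\nu_2$;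 $s_5:\nu_5\leftrightarrow\nu_6$; $s_2:\ \nu_3\to\kappa_1/\nu_7,\ \nu_7\to\kappa_1/\nu_3,\ \kappa_2\to\kappa_1\kappa_2/(\nu_3\nu_7),\ g\to g\frac{f-\nu_3}{f-\kappa_1/\nu_7}$; $s_3:\ \nu_1\to\kappa_2/\nu_5,\ \nu_5\to\kappa_2/\nu_1,\ \kappa_1\to\kappa_1\kappa_2/(\nu_1\nu_5),\ f\to f\frac{g-1/\nu_1}{g-\nu_5/\kappa_2}$. Products are compositions of automorphisms: $(s_is_j)(h)=s_i(s_j(h))$. *)

theory Defs
  imports
    "HOL-Analysis.Analysis"
    "HOL-Library.Poly_Mapping"
    "HOL-Computational_Algebra.Fraction_Field"
begin

section \<open>Polynomials and rational functions in several variables\<close>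

type_synonym 'v mpoly = "('v \<Rightarrow>\<^sub>0 nat) \<Rightarrow>\<^sub>0 complex"

definition peval :: "(complex \<Rightarrow> 'k) \<Rightarrow> ('v \<Rightarrow> 'k) \<Rightarrow> 'v mpoly \<Rightarrow> 'k::field" where
  "peval h \<sigma> P =
     (\<Sum>m\<in>Poly_Mapping.keys P. h (Poly_Mapping.lookup P m) *
        (\<Prod>v\<in>Poly_Mapping.keys m. \<sigma> v ^ Poly_Mapping.lookup m v))"

text \<open>
  The rational function \<open>r\<close> is regular at \<open>\<sigma>\<close> and has the value \<open>u\<close> there.  The value is unique,
  because any two representations of \<open>r\<close> with nonvanishing denominator give the same quotient.
\<close>
definition rat_val ::
  "(complex \<Rightarrow> 'k) \<Rightarrow> ('v::linorder \<Rightarrow> 'k) \<Rightarrow> 'v mpoly fract \<Rightarrow> 'k::field \<Rightarrow> bool" where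
  "rat_val h \<sigma> r u \<longleftrightarrow>
     (\<exists>n d. r = Fract n d \<and> peval h \<sigma> d \<noteq> 0 \<and> u = peval h \<sigma> n / peval h \<sigma> d)"


section \<open>The affine Weyl group action\<close>

datatype wvar = K1 | K2 | N1 | N2 | N3 | N4 | N5 | N6 | N7 | N8 | VF | VG

text \<open>
  The order on the variables has no mathematical content: the library proves that a polynomial ring
  has no zero divisors only for linearly ordered monomials.
\<close>
instantiation wvar :: linorder
begin

primrec wvar_index :: "wvar \<Rightarrow> nat" where
  "wvar_index K1 = 0" | "wvar_index K2 = 1" | "wvar_index N1 = 2" | "wvar_index N2 = 3"
| "wvar_index N3 = 4" | "wvar_index N4 = 5" | "wvar_index N5 = 6" | "wvar_index N6 = 7"
| "wvar_index N7 = 8" | "wvar_index N8 = 9" | "wvar_index VF = 10" | "wvar_index VG = 11"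

definition less_eq_wvar :: "wvar \<Rightarrow> wvar \<Rightarrow> bool" where
  "less_eq_wvar u v \<longleftrightarrow> wvar_index u \<le> wvar_index v"

definition less_wvar :: "wvar \<Rightarrow> wvar \<Rightarrow> bool" where
  "less_wvar u v \<longleftrightarrow> wvar_index u < wvar_index v"

instance
proof
  fix u v :: wvar
  assume "u \<le> v" "v \<le> u"
  then show "u = v"
    unfolding less_eq_wvar_def by (cases u; cases v; simp)
qed (auto simp: less_eq_wvar_def less_wvar_def)

end

type_synonym wfield = "wvar mpoly fract"

definition X :: "wvar \<Rightarrow> wfield" where
  "X v = Fract (Poly_Mapping.single (Poly_Mapping.single v 1) 1) 1"

definition const :: "complex \<Rightarrow> wfield" where
  "const c = Fract (Poly_Mapping.single 0 c) 1"

abbreviation "\<kappa>1 \<equiv> X K1"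
abbreviation "\<kappa>2 \<equiv> X K2"
abbreviation "\<nu>1 \<equiv> X N1"
abbreviation "\<nu>2 \<equiv> X N2"
abbreviation "\<nu>3 \<equiv> X N3"
abbreviation "\<nu>4 \<equiv> X N4"
abbreviation "\<nu>5 \<equiv> X N5"
abbreviation "\<nu>6 \<equiv> X N6"
abbreviation "\<nu>7 \<equiv> X N7"
abbreviation "\<nu>8 \<equiv> X N8"
abbreviation "\<ff> \<equiv> X VF"
abbreviation "\<gg> \<equiv> X VG"

text \<open>
  The constraint $\kappa_1^2\kappa_2^2 = q\nu_1\cdots\nu_8$ is solved for $q$, so that the twelve
  remaining variables are independent; all $s_i$ then fix $q$.
\<close>
definition q_W :: wfield where
  "q_W = \<kappa>1^2 * \<kappa>2^2 / (\<nu>1 * \<nu>2 * \<nu>3 * \<nu>4 * \<nu>5 * \<nu>6 * \<nu>7 * \<nu>8)"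

text \<open>
  The endomorphism of the field over the complex numbers with \<open>X v \<mapsto> \<sigma> v\<close>.  It is defined
  everywhere when the images \<open>\<sigma> v\<close> are algebraically independent, as they are for the generators
  below.
\<close>
definition subst :: "(wvar \<Rightarrow> wfield) \<Rightarrow> wfield \<Rightarrow> wfield" where
  "subst \<sigma> r = (THE u. rat_val const \<sigma> r u)"

definition s0 :: "wfield \<Rightarrow> wfield" where
  "s0 = subst (X(N7 := \<nu>8, N8 := \<nu>7))"

definition s1 :: "wfield \<Rightarrow> wfield" where
  "s1 = subst (X(N3 := \<nu>4, N4 := \<nu>3))"

definition s2 :: "wfield \<Rightarrow> wfield" where
  "s2 = subst (X(N3 := \<kappa>1 / \<nu>7, N7 := \<kappa>1 / \<nu>3, K2 := \<kappa>1 * \<kappa>2 / (\<nu>3 * \<nu>7),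
                 VG := \<gg> * ((\<ff> - \<nu>3) / (\<ff> - \<kappa>1 / \<nu>7))))"

definition s3 :: "wfield \<Rightarrow> wfield" where
  "s3 = subst (X(N1 := \<kappa>2 / \<nu>5, N5 := \<kappa>2 / \<nu>1, K1 := \<kappa>1 * \<kappa>2 / (\<nu>1 * \<nu>5),
                 VF := \<ff> * ((\<gg> - 1 / \<nu>1) / (\<gg> - \<nu>5 / \<kappa>2))))"

definition s4 :: "wfield \<Rightarrow> wfield" where
  "s4 = subst (X(N1 := \<nu>2, N2 := \<nu>1))"

definition s5 :: "wfield \<Rightarrow> wfield" where
  "s5 = subst (X(N5 := \<nu>6, N6 := \<nu>5))"


section \<open>The linear system and its parameters\<close>

datatype par = Q | T | A1 | A2 | A3 | A4 | Chi1 | Chi2 | Th1 | Th2 | W | Y | Z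

definition admissible :: "(par \<Rightarrow> complex) \<Rightarrow> bool" where
  "admissible p \<longleftrightarrow> (\<forall>i. p i \<noteq> 0) \<and>
     p Chi1 * p Chi2 * p A1 * p A2 * p A3 * p A4 = p Th1 * p Th2"

text \<open>
  Validity on a nonempty Zariski open subset of the variety of admissible parameters.  That variety
  is irreducible (solve the constraint for $\theta_2$), so such a subset is dense.
\<close>
definition generically :: "((par \<Rightarrow> complex) \<Rightarrow> bool) \<Rightarrow> bool" where
  "generically R \<longleftrightarrow>
     (\<exists>P :: par mpoly. (\<exists>p. admissible p \<and> peval id p P \<noteq> 0) \<and>
        (\<forall>p. admissible p \<and> peval id p P \<noteq> 0 \<longrightarrow> R p))"

definition smul :: "complex \<Rightarrow> complex^'n^'m \<Rightarrow> complex^'n^'m" (infixr \<open>\<odot>\<close> 75) where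
  "c \<odot> M = (\<chi> i j. c * M $ i $ j)"

definition diag2 :: "complex \<Rightarrow> complex \<Rightarrow> complex^2^2" where
  "diag2 a b = vector [vector [a, 0], vector [0, b]]"

text \<open>The eigenvalues of \<open>M\<close> are \<open>a\<close> and \<open>b\<close>, counted with algebraic multiplicity.\<close>
definition eigenvalues2 :: "complex^2^2 \<Rightarrow> complex \<Rightarrow> complex \<Rightarrow> bool" where
  "eigenvalues2 M a b \<longleftrightarrow> (\<forall>x. det (mat x - M) = (x - a) * (x - b))"

definition lax_matrix :: "(par \<Rightarrow> complex) \<Rightarrow> (complex \<Rightarrow> complex^2^2) \<Rightarrow> bool" where
  "lax_matrix p A \<longleftrightarrow>
     (\<exists>M0 M1 M2. (\<forall>x. A x = M0 + x \<odot> M1 + x^2 \<odot> M2) \<and>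
        M2 = diag2 (p Chi1) (p Chi2) \<and>
        eigenvalues2 M0 (p T * p Th1) (p T * p Th2)) \<and>
     (\<forall>x. det (A x) = p Chi1 * p Chi2 * (x - p T * p A1) * (x - p T * p A2)
                        * (x - p A3) * (x - p A4)) \<and>
     (\<forall>x. A x $ 1 $ 2 = p Chi2 * p W * (x - p Y)) \<and>
     A (p Y) $ 1 $ 1 = (p Y - p T * p A1) * (p Y - p T * p A2) / (p Q * p Z)"

definition fuchsian ::
  "(par \<Rightarrow> complex) \<Rightarrow> complex^2^2 \<Rightarrow> complex^2^2 \<Rightarrow> complex^2^2 \<Rightarrow> complex \<Rightarrow> complex^2^2" where
  "fuchsian p Minf M1 M2 x =
     Minf + (1 / (1 - x / (p T * p A1))) \<odot> M1 + (1 / (1 - x / (p T * p A2))) \<odot> M2"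


section \<open>The middle convolution\<close>

text \<open>The index \<open>(i, k)\<close> of a vector or matrix stands for entry \<open>k\<close> of block \<open>i\<close>.\<close>

definition block :: "complex^(3 \<times> 2) \<Rightarrow> 3 \<Rightarrow> complex^2" where
  "block v i = (\<chi> k. v $ (i, k))"

definition block_matrix :: "complex^2^2^3^3 \<Rightarrow> complex^(3 \<times> 2)^(3 \<times> 2)" where
  "block_matrix N = (\<chi> a b. N $ fst a $ fst b $ snd a $ snd b)"

text \<open>The classes of \<open>e 1\<close>, \<open>e 2\<close> form a basis of the quotient by the subspace \<open>S\<close>.\<close>
definition quotient_basis :: "(complex^'n) set \<Rightarrow> (2 \<Rightarrow> complex^'n) \<Rightarrow> bool" where
  "quotient_basis S e \<longleftrightarrow> (\<forall>v. \<exists>!c :: complex^2. v - (\<Sum>i\<in>UNIV. c $ i *s e i) \<in> S)"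

text \<open>\<open>M\<close> is the matrix, in that basis, of the map which \<open>F\<close> induces on the quotient.\<close>
definition induces ::
  "(complex^'n) set \<Rightarrow> (2 \<Rightarrow> complex^'n) \<Rightarrow> complex^'n^'n \<Rightarrow> complex^2^2 \<Rightarrow> bool" where
  "induces S e F M \<longleftrightarrow> (\<forall>j. F *v e j - (\<Sum>i\<in>UNIV. M $ i $ j *s e i) \<in> S)"

text \<open>
  \<open>Ginf\<close>, \<open>G1\<close>, \<open>G2\<close> are the matrices $\overline F_\infty$, $\overline F_1$, $\overline F_2$ with
  respect to some diagonalizing basis of the quotient; \<open>ql\<close> is $q^\lambda$.
\<close>
definition middle_convolution ::
  "(par \<Rightarrow> complex) \<Rightarrow> (complex \<Rightarrow> complex^2^2) \<Rightarrow>
     complex^2^2 \<Rightarrow> complex^2^2 \<Rightarrow> complex^2^2 \<Rightarrow> bool" where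
  "middle_convolution p A Ginf G1 G2 \<longleftrightarrow>
     (\<exists>Binf B0 B1 B2 e.
        (\<forall>x. x \<noteq> p T * p A1 \<longrightarrow> x \<noteq> p T * p A2 \<longrightarrow>
           (p T * p A1 * p A2 / p Th1 / ((x - p T * p A1) * (x - p T * p A2))) \<odot> A x
             = fuchsian p Binf B1 B2 x) \<and>
        B0 = mat 1 - Binf - B1 - B2 \<and>
        (let ql = p Chi2 * p T * p A1 * p A2 / p Th1;
             F1 = block_matrix (vector
                    [vector [0, 0, 0],
                     vector [B0, B1 - mat (1 - ql), B2],
                     vector [0, 0, 0]]);
             F2 = block_matrix (vector
                    [vector [0, 0, 0],
                     vector [0, 0, 0],
                     vector [B0, B1, B2 - mat (1 - ql)]]);
             Fhat = block_matrix (vector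
                    [vector [B0, B1, B2],
                     vector [B0, B1, B2],
                     vector [B0, B1, B2]]);
             Finf = mat 1 - Fhat;
             K = {v. B0 *v block v 1 = 0 \<and> B1 *v block v 2 = 0 \<and> B2 *v block v 3 = 0};
             L = {v. (Fhat - mat (1 - ql)) *v v = 0};
             S = {u + v | u v. u \<in> K \<and> v \<in> L}
         in quotient_basis S e \<and>
            induces S e Finf Ginf \<and> induces S e F1 G1 \<and> induces S e F2 G2 \<and>
            Ginf = diag2 (p Chi1 * p T * p A1 * p A2 / p Th1) 1))"


section \<open>The change of variables\<close>

text \<open>
  It fixes $\kappa_1,\kappa_2,\nu_5,\dots,\nu_8$ only up to rescaling $(\kappa_1,\nu_7,\nu_8)$ and
  $(\kappa_2,\nu_5,\nu_6)$, hence is a relation.  The constraint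
  $\kappa_1^2\kappa_2^2 = q\nu_1\cdots\nu_8$ follows for admissible \<open>p\<close>.
\<close>
definition change_of_variables :: "(par \<Rightarrow> complex) \<Rightarrow> (wvar \<Rightarrow> complex) \<Rightarrow> bool" where
  "change_of_variables p \<xi> \<longleftrightarrow>
     \<xi> VG = p Q * p Z \<and> \<xi> VF = p Y \<and>
     \<xi> N1 = p Chi1 \<and> p Q * \<xi> N2 = p Chi2 \<and>
     \<xi> N5 / \<xi> K2 = p T * p A1 * p A2 / p Th1 \<and>
     \<xi> N6 / \<xi> K2 = p T * p A1 * p A2 / p Th2 \<and>
     \<xi> N3 = p A3 \<and> \<xi> N4 = p A4 \<and>
     \<xi> K1 / \<xi> N7 = p T * p A1 \<and> \<xi> K1 / \<xi> N8 = p T * p A2"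

end

theory Submission
  imports Defs
begin

text \<open>
  Each residue $B_i$ has rank one, $B_i = (1, m_i)^T (p_i, r_i)$, so modulo $\mathcal K$ a block
  vector is given by three numbers, and $\mathcal L$ becomes the line of $r = (r_0, r_1, r_2)$.  The
  linear forms $(1,1,1)$ and $p \times r$ annihilate $r$, give coordinates on the quotient, and
  diagonalize $F_\infty$; in them $\overline F_1$ and $\overline F_2$ have rank one as well, with
  entries that are explicit in $m_i, p_i, r_i$.  The identity $\overline B_{22}(\widetilde y) =
  B_{22}(y)$ between the lower right entries at the zeros of the upper right ones determines
  $\widetilde y$ and $\widetilde z$.

  Each $s_i$ used is an involution on the variables, hence an injective substitution and a field
  automorphism.  The word factors as $s_5 \cdot c \cdot s_3 \cdot c$ with $c = s_2 s_1 s_0 s_2$, and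
  $c$ multiplies $g$ by $\frac{(f-\nu_3)(f-\nu_4)}{(f-\kappa_1/\nu_7)(f-\kappa_1/\nu_8)}$.
\<close>

section \<open>Evaluation of polynomials and rational functions\<close>

text \<open>Two quantities tie both sides together: q^lambda, which is \<open>rho\<close> for the
  parameters and \<open>rho_W\<close> in the function field, and \<open>b\<close>, the lower right
  entry of B(y). The lower right entries of the residues give
  \<open>1 - rho = s * V * (y - yt)\<close> and \<open>1 - b = y * s * V\<close>; eliminating
  \<open>s * V\<close> yields the new zero y (b - rho) / (b - 1). On the Weyl group side b is the
  value of \<open>rho_W * \<nu>1 * E_W * \<gg>\<close>, and the same fraction comes out of
  \<open>s3\<close> between its two conjugating factors. Two things shape the proof. A diagonalizing
  basis of the quotient leaves one scale \<open>k\<close> free; it enters the new upper right entry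
  only as a constant factor, so it is absorbed by \<open>W\<close>, which has no counterpart among
  the variables of the Weyl group. And \<open>subst\<close> is a definite description, so a
  substitution is usable as a homomorphism only once every rational function is known to have a
  value under it.\<close>

locale field_hom =
  fixes h :: "'a::field \<Rightarrow> 'b::field"
  assumes hom_one [simp]: "h 1 = 1"
    and hom_add [simp]: "h (a + b) = h a + h b"
    and hom_mult [simp]: "h (a * b) = h a * h b"
begin

lemma hom_zero [simp]: "h 0 = 0"
  using hom_add[of 0 0] by (metis add.right_neutral add_left_cancel)

lemma hom_minus [simp]: "h (- a) = - h a"
  using hom_add[of a "- a"] by (simp add: eq_neg_iff_add_eq_0 add.commute)

lemma hom_diff [simp]: "h (a - b) = h a - h b"
  using hom_add[of a "- b"] by simp

lemma hom_eq_zero_iff [simp]: "h a = 0 \<longleftrightarrow> a = 0"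
proof
  assume "h a = 0"
  then have "h (a * inverse a) = 0" by simp
  then show "a = 0" by (cases "a = 0") (simp_all del: hom_mult)
qed simp

lemma hom_inverse [simp]: "h (inverse a) = inverse (h a)"
proof (cases "a = 0")
  case False
  then have "h a * h (inverse a) = 1" using hom_mult[of a "inverse a"] by simp
  then show ?thesis by (metis inverse_unique)
qed simp

lemma hom_divide [simp]: "h (a / b) = h a / h b"
  by (simp add: divide_inverse)

lemma hom_power [simp]: "h (a ^ n) = h a ^ n"
  by (induction n) simp_all

end

lemma field_hom_id: "field_hom id"
  by unfold_locales simp_all

text \<open>The added term may overlap the support of \<open>f\<close>. This suits additive
  evaluations, for which a fresh key would bring no gain.\<close>

lemma poly_mapping_induct_add [case_names zero add]:
  assumes "P 0" and "\<And>f a b. P f \<Longrightarrow> P (f + Poly_Mapping.single a b)"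
  shows "P (f :: 'a \<Rightarrow>\<^sub>0 'b::comm_monoid_add)"
proof (induction f rule: update_induct)
  case (update f a b)
  have "Poly_Mapping.update a b f = f + Poly_Mapping.single a b"
    by (rule poly_mapping_eqI)
      (use update in \<open>auto simp: lookup_update lookup_add lookup_single in_keys_iff\<close>)
  with update assms(2) show ?case by simp
qed (rule assms(1))

definition monom_val :: "('v \<Rightarrow> 'k::field) \<Rightarrow> ('v \<Rightarrow>\<^sub>0 nat) \<Rightarrow> 'k" where
  "monom_val \<sigma> m = (\<Prod>v\<in>Poly_Mapping.keys m. \<sigma> v ^ Poly_Mapping.lookup m v)"

text \<open>Exponents outside the support are 0 and contribute the factor 1, so monomials with
  different supports can be compared over one common index set.\<close>

lemma monom_val_superset:
  assumes "finite V" "Poly_Mapping.keys m \<subseteq> V"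
  shows "monom_val \<sigma> m = (\<Prod>v\<in>V. \<sigma> v ^ Poly_Mapping.lookup m v)"
  unfolding monom_val_def using assms
  by (intro prod.mono_neutral_left) (auto simp: in_keys_iff)

lemma monom_val_0 [simp]: "monom_val \<sigma> 0 = 1"
  by (simp add: monom_val_def)

lemma monom_val_single [simp]: "monom_val \<sigma> (Poly_Mapping.single v n) = \<sigma> v ^ n"
  by (subst monom_val_superset[of "{v}"]) simp_all

lemma monom_val_add: "monom_val \<sigma> (m + n) = monom_val \<sigma> m * monom_val \<sigma> n"
proof -
  let ?V = "Poly_Mapping.keys m \<union> Poly_Mapping.keys n"
  have "finite ?V" "Poly_Mapping.keys (m + n) \<subseteq> ?V"
    using keys_add[of m n] by auto
  then show ?thesis
    by (simp add: monom_val_superset[of ?V] lookup_add power_add prod.distrib)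
qed

lemma peval_superset:
  assumes "field_hom h" "finite M" "Poly_Mapping.keys P \<subseteq> M"
  shows "peval h \<sigma> P = (\<Sum>m\<in>M. h (Poly_Mapping.lookup P m) * monom_val \<sigma> m)"
proof -
  interpret field_hom h by fact
  show ?thesis unfolding peval_def monom_val_def[symmetric] using assms(2,3)
    by (intro sum.mono_neutral_left) (auto simp: in_keys_iff)
qed

lemma peval_0 [simp]: "peval h \<sigma> 0 = 0"
  by (simp add: peval_def)

lemma peval_single:
  assumes "field_hom h"
  shows "peval h \<sigma> (Poly_Mapping.single m c) = h c * monom_val \<sigma> m"
  by (subst peval_superset[OF assms, of "{m}"]) simp_all

lemma peval_1: "field_hom h \<Longrightarrow> peval h \<sigma> 1 = 1"
  by (simp add: peval_single field_hom.hom_one flip: single_one)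

lemma peval_add:
  assumes "field_hom h"
  shows "peval h \<sigma> (P + R) = peval h \<sigma> P + peval h \<sigma> R"
proof -
  interpret field_hom h by fact
  let ?M = "Poly_Mapping.keys P \<union> Poly_Mapping.keys R"
  have "finite ?M" "Poly_Mapping.keys (P + R) \<subseteq> ?M"
    using keys_add[of P R] by auto
  then show ?thesis
    by (simp add: peval_superset[OF assms, of ?M] lookup_add distrib_right sum.distrib)
qed

lemma peval_mult:
  assumes "field_hom h"
  shows "peval h \<sigma> (P * R) = peval h \<sigma> P * peval h \<sigma> R"
proof -
  interpret field_hom h by fact
  have single: "peval h \<sigma> (Poly_Mapping.single a b * R)
      = peval h \<sigma> (Poly_Mapping.single a b) * peval h \<sigma> R" for a b
    by (induction R rule: poly_mapping_induct_add)
      (simp_all add: distrib_left peval_add[OF assms] peval_single[OF assms] mult_single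
        monom_val_add mult_ac)
  show ?thesis
    by (induction P rule: poly_mapping_induct_add)
      (simp_all add: distrib_right peval_add[OF assms] single)
qed

lemma rat_val_unique:
  assumes h: "field_hom h" and u: "rat_val h \<sigma> r u" and v: "rat_val h \<sigma> r v"
  shows "u = v"
proof -
  obtain n d where r1: "r = Fract n d" and d: "peval h \<sigma> d \<noteq> 0"
    and u: "u = peval h \<sigma> n / peval h \<sigma> d" using u by (auto simp: rat_val_def)
  obtain n' d' where r2: "r = Fract n' d'" and d': "peval h \<sigma> d' \<noteq> 0"
    and v: "v = peval h \<sigma> n' / peval h \<sigma> d'" using v by (auto simp: rat_val_def)
  have "d \<noteq> 0" "d' \<noteq> 0" using d d' by auto
  then have "n * d' = n' * d" using r1 r2 by (simp add: eq_fract)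
  then have "peval h \<sigma> n * peval h \<sigma> d' = peval h \<sigma> n' * peval h \<sigma> d"
    by (metis peval_mult[OF h])
  then show ?thesis using d d' u v by (simp add: frac_eq_eq)
qed

lemma rat_val_Fract_1: "field_hom h \<Longrightarrow> rat_val h \<sigma> (Fract P 1) (peval h \<sigma> P)"
  unfolding rat_val_def by (rule exI[of _ P], rule exI[of _ 1]) (simp add: peval_1)

lemma rat_val_1: "field_hom h \<Longrightarrow> rat_val h \<sigma> 1 1"
  using rat_val_Fract_1[of h \<sigma> 1] by (simp add: One_fract_def peval_1)

lemma rat_val_0: "field_hom h \<Longrightarrow> rat_val h \<sigma> 0 0"
  using rat_val_Fract_1[of h \<sigma> 0] by (simp add: Zero_fract_def)

lemma rat_val_X: "field_hom h \<Longrightarrow> rat_val h \<sigma> (X v) (\<sigma> v)"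
  using rat_val_Fract_1[of h \<sigma> "Poly_Mapping.single (Poly_Mapping.single v 1) 1"]
  by (simp add: X_def peval_single field_hom.hom_one)

lemma rat_val_const: "field_hom h \<Longrightarrow> rat_val h \<sigma> (const c) (h c)"
  using rat_val_Fract_1[of h \<sigma> "Poly_Mapping.single 0 c"] by (simp add: const_def peval_single)

lemma rat_val_add:
  assumes h: "field_hom h" and "rat_val h \<sigma> r u" "rat_val h \<sigma> s v"
  shows "rat_val h \<sigma> (r + s) (u + v)"
proof -
  obtain n d where r: "r = Fract n d" "peval h \<sigma> d \<noteq> 0" "u = peval h \<sigma> n / peval h \<sigma> d"
    using assms(2) by (auto simp: rat_val_def)
  obtain n' d' where s: "s = Fract n' d'" "peval h \<sigma> d' \<noteq> 0" "v = peval h \<sigma> n' / peval h \<sigma> d'"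
    using assms(3) by (auto simp: rat_val_def)
  have "d \<noteq> 0" "d' \<noteq> 0" using r s by auto
  then have "r + s = Fract (n * d' + n' * d) (d * d')" by (simp add: r s)
  then show ?thesis unfolding rat_val_def
    by (intro exI conjI, assumption)
      (use r s in \<open>auto simp: peval_mult[OF h] peval_add[OF h] add_frac_eq\<close>)
qed

lemma rat_val_mult:
  assumes h: "field_hom h" and "rat_val h \<sigma> r u" "rat_val h \<sigma> s v"
  shows "rat_val h \<sigma> (r * s) (u * v)"
proof -
  obtain n d where r: "r = Fract n d" "peval h \<sigma> d \<noteq> 0" "u = peval h \<sigma> n / peval h \<sigma> d"
    using assms(2) by (auto simp: rat_val_def)
  obtain n' d' where s: "s = Fract n' d'" "peval h \<sigma> d' \<noteq> 0" "v = peval h \<sigma> n' / peval h \<sigma> d'"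
    using assms(3) by (auto simp: rat_val_def)
  have "r * s = Fract (n * n') (d * d')" by (simp add: r s)
  then show ?thesis unfolding rat_val_def
    by (intro exI conjI, assumption) (use r s in \<open>auto simp: peval_mult[OF h]\<close>)
qed

lemma rat_val_minus:
  assumes h: "field_hom h" and "rat_val h \<sigma> r u"
  shows "rat_val h \<sigma> (- r) (- u)"
proof -
  obtain n d where r: "r = Fract n d" "peval h \<sigma> d \<noteq> 0" "u = peval h \<sigma> n / peval h \<sigma> d"
    using assms(2) by (auto simp: rat_val_def)
  have "peval h \<sigma> (- n) = - peval h \<sigma> n"
    using peval_add[OF h, of \<sigma> n "- n"] by (simp add: eq_neg_iff_add_eq_0 add.commute)
  then show ?thesis unfolding rat_val_def
    by (intro exI[of _ "- n"] exI[of _ d]) (simp add: r)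
qed

lemma rat_val_inverse:
  assumes h: "field_hom h" and "rat_val h \<sigma> r u" "u \<noteq> 0"
  shows "rat_val h \<sigma> (inverse r) (inverse u)"
proof -
  obtain n d where r: "r = Fract n d" "peval h \<sigma> d \<noteq> 0" "u = peval h \<sigma> n / peval h \<sigma> d"
    using assms(2) by (auto simp: rat_val_def)
  have "inverse r = Fract d n" by (simp add: r)
  then show ?thesis unfolding rat_val_def
    by (intro exI conjI, assumption) (use r assms(3) in auto)
qed

lemma rat_val_diff:
  assumes "field_hom h" "rat_val h \<sigma> r u" "rat_val h \<sigma> s v"
  shows "rat_val h \<sigma> (r - s) (u - v)"
  using rat_val_add[OF assms(1,2) rat_val_minus[OF assms(1,3)]] by simp

lemma rat_val_divide:
  assumes "field_hom h" "rat_val h \<sigma> r u" "rat_val h \<sigma> s v" "v \<noteq> 0"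
  shows "rat_val h \<sigma> (r / s) (u / v)"
  using rat_val_mult[OF assms(1,2) rat_val_inverse[OF assms(1,3,4)]]
  by (simp add: divide_inverse)

lemma rat_val_power:
  assumes "field_hom h" "rat_val h \<sigma> r u"
  shows "rat_val h \<sigma> (r ^ n) (u ^ n)"
  by (induction n) (simp_all add: rat_val_1 rat_val_mult assms)

lemmas rat_val_intros = rat_val_1 rat_val_0 rat_val_X rat_val_const rat_val_add rat_val_mult
  rat_val_minus rat_val_inverse rat_val_diff rat_val_divide rat_val_power

lemma rat_val_nonzero: "field_hom h \<Longrightarrow> rat_val h \<sigma> r u \<Longrightarrow> u \<noteq> 0 \<Longrightarrow> r \<noteq> 0"
  using rat_val_0 rat_val_unique by blast

lemma field_hom_const: "field_hom const"
proof
  show "const 1 = 1" by (simp add: const_def One_fract_def)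
  show "const (a + b) = const a + const b" for a b by (simp add: const_def single_add)
  show "const (a * b) = const a * const b" for a b by (simp add: const_def mult_single)
qed

text \<open>
  Evaluating \<open>peval const \<sigma> P\<close> at the inverting values \<open>\<tau>\<close> gives back \<open>P\<close>, hence \<open>\<sigma>\<close>
  takes no nonzero denominator to zero.
\<close>
lemma rat_val_total:
  assumes inv: "\<And>v. rat_val const \<tau> (\<sigma> v) (X v)"
  shows "\<exists>u. rat_val const \<sigma> r u"
proof -
  note hom = field_hom_const
  have val: "rat_val const \<tau> (peval const \<sigma> P) (Fract P 1)" for P
  proof (induction P rule: poly_mapping_induct_add)
    case zero
    then show ?case using rat_val_0[OF hom] by (simp add: Zero_fract_def)
  next
    case (add P m c)
    have pow: "rat_val const \<tau> (\<sigma> v ^ n) (Fract (Poly_Mapping.single (Poly_Mapping.single v n) 1) 1)"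
      for v n
    proof (induction n)
      case 0
      then show ?case using rat_val_1[OF hom] by (simp add: One_fract_def)
    next
      case (Suc n)
      then show ?case using rat_val_mult[OF hom inv[of v] Suc]
        by (simp add: X_def mult_single flip: single_add)
    qed
    have monom: "rat_val const \<tau> (monom_val \<sigma> m) (Fract (Poly_Mapping.single m 1) 1)"
    proof (induction m rule: poly_mapping_induct_add)
      case zero
      then show ?case using rat_val_1[OF hom] by (simp add: One_fract_def)
    next
      case (add m v n)
      then show ?case using rat_val_mult[OF hom add pow[of v n]]
        by (simp add: monom_val_add mult_single)
    qed
    have "rat_val const \<tau> (const c * monom_val \<sigma> m) (Fract (Poly_Mapping.single m c) 1)"
      using rat_val_mult[OF hom rat_val_const[OF hom, of \<tau> c] monom]
      by (simp add: const_def mult_single)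
    from rat_val_add[OF hom add.IH this] show ?case
      by (simp add: peval_add[OF hom] peval_single[OF hom])
  qed
  obtain n d where r: "r = Fract n d" "d \<noteq> 0" by (cases r)
  have "peval const \<sigma> d \<noteq> 0"
  proof
    assume "peval const \<sigma> d = 0"
    then have "Fract d 1 = 0"
      using val[of d] rat_val_0[OF hom] rat_val_unique[OF hom] by metis
    with \<open>d \<noteq> 0\<close> show False by (simp add: Zero_fract_def eq_fract)
  qed
  with r show ?thesis unfolding rat_val_def by blast
qed

section \<open>Substitutions as endomorphisms of the function field\<close>

lemma subst_eqI: "rat_val const \<sigma> r u \<Longrightarrow> subst \<sigma> r = u"
  unfolding subst_def using rat_val_unique[OF field_hom_const] by blast

text \<open>The hypothesis gives \<open>\<sigma>\<close> a left inverse \<open>\<tau>\<close> on the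
  generators, which makes the description in \<open>subst\<close> total. For each generator of the
  group \<open>\<tau>\<close> is \<open>\<sigma>\<close> itself.\<close>

lemma field_hom_subst:
  assumes "\<And>v. rat_val const \<tau> (\<sigma> v) (X v)"
  shows "field_hom (subst \<sigma>)"
proof
  have val: "rat_val const \<sigma> r (subst \<sigma> r)" for r
    using rat_val_total[OF assms, of r] subst_eqI by metis
  show "subst \<sigma> 1 = 1" by (rule subst_eqI[OF rat_val_1[OF field_hom_const]])
  show "subst \<sigma> (a + b) = subst \<sigma> a + subst \<sigma> b" for a b
    by (rule subst_eqI[OF rat_val_add[OF field_hom_const val val]])
  show "subst \<sigma> (a * b) = subst \<sigma> a * subst \<sigma> b" for a b
    by (rule subst_eqI[OF rat_val_mult[OF field_hom_const val val]])
qed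

lemma subst_X: "subst \<sigma> (X v) = \<sigma> v"
  by (rule subst_eqI[OF rat_val_X[OF field_hom_const]])

section \<open>The word in the affine Weyl group\<close>

lemma X_nonzero [simp]: "X v \<noteq> 0"
  using rat_val_nonzero[OF field_hom_id rat_val_X[OF field_hom_id, of "\<lambda>_. 1"]] by simp

text \<open>A rational function is nonzero as soon as it has a nonzero value at one complex point;
  here f = 2 and all other variables are 1. The next three lemmas argue alike.\<close>

lemma f_minus_nu3_nonzero: "\<ff> - \<nu>3 \<noteq> 0"
  by (rule rat_val_nonzero[OF field_hom_id, where \<sigma> = "(\<lambda>_. 1)(VF := 2)"])
    (rule rat_val_intros field_hom_id | simp)+

lemma f_minus_kappa1_nu7_nonzero: "\<ff> - \<kappa>1 / \<nu>7 \<noteq> 0"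
  by (rule rat_val_nonzero[OF field_hom_id, where \<sigma> = "(\<lambda>_. 1)(VF := 2)"])
    (rule rat_val_intros field_hom_id | simp)+

lemma g_minus_inverse_nu1_nonzero: "\<gg> - 1 / \<nu>1 \<noteq> 0"
  by (rule rat_val_nonzero[OF field_hom_id, where \<sigma> = "(\<lambda>_. 1)(VG := 2)"])
    (rule rat_val_intros field_hom_id | simp)+

lemma g_minus_nu5_kappa2_nonzero: "\<gg> - \<nu>5 / \<kappa>2 \<noteq> 0"
  by (rule rat_val_nonzero[OF field_hom_id, where \<sigma> = "(\<lambda>_. 1)(VG := 2)"])
    (rule rat_val_intros field_hom_id | simp)+

lemma rat_val_eq: "rat_val h \<sigma> r u \<Longrightarrow> u = v \<Longrightarrow> rat_val h \<sigma> r v"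
  by simp

lemma field_hom_s0: "field_hom s0"
  unfolding s0_def
proof (rule field_hom_subst)
  show "rat_val const (X(N7 := \<nu>8, N8 := \<nu>7)) ((X(N7 := \<nu>8, N8 := \<nu>7)) v) (X v)" for v
    by (cases v) (auto intro: rat_val_eq[OF rat_val_X[OF field_hom_const]])
qed

lemma field_hom_s1: "field_hom s1"
  unfolding s1_def
proof (rule field_hom_subst)
  show "rat_val const (X(N3 := \<nu>4, N4 := \<nu>3)) ((X(N3 := \<nu>4, N4 := \<nu>3)) v) (X v)" for v
    by (cases v) (auto intro: rat_val_eq[OF rat_val_X[OF field_hom_const]])
qed

lemma field_hom_s5: "field_hom s5"
  unfolding s5_def
proof (rule field_hom_subst)
  show "rat_val const (X(N5 := \<nu>6, N6 := \<nu>5)) ((X(N5 := \<nu>6, N6 := \<nu>5)) v) (X v)" for v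
    by (cases v) (auto intro: rat_val_eq[OF rat_val_X[OF field_hom_const]])
qed

lemma field_hom_s2: "field_hom s2"
  unfolding s2_def
proof (rule field_hom_subst)
  fix v
  let ?\<sigma> = "X(N3 := \<kappa>1 / \<nu>7, N7 := \<kappa>1 / \<nu>3, K2 := \<kappa>1 * \<kappa>2 / (\<nu>3 * \<nu>7),
                 VG := \<gg> * ((\<ff> - \<nu>3) / (\<ff> - \<kappa>1 / \<nu>7)))"
  note intros = rat_val_mult[OF field_hom_const] rat_val_divide[OF field_hom_const]
    rat_val_diff[OF field_hom_const] rat_val_X[OF field_hom_const]
  note nonzero = f_minus_nu3_nonzero f_minus_kappa1_nu7_nonzero
  have "rat_val const ?\<sigma> (\<kappa>1 / \<nu>7) \<nu>3"
    by (rule rat_val_eq, (rule intros | simp)+)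
  moreover have "rat_val const ?\<sigma> (\<kappa>1 / \<nu>3) \<nu>7"
    by (rule rat_val_eq, (rule intros | simp)+)
  moreover have "rat_val const ?\<sigma> (\<kappa>1 * \<kappa>2 / (\<nu>3 * \<nu>7)) \<kappa>2"
    by (rule rat_val_eq, (rule intros | simp)+)
  \<comment> \<open>The substitution exchanges \<open>\<nu>3\<close> with
    \<open>\<kappa>1 / \<nu>7\<close>, so the factor acquired by \<open>\<gg>\<close> becomes its
    own inverse; both differences must be nonzero to cancel.\<close>
  moreover have "rat_val const ?\<sigma> (\<gg> * ((\<ff> - \<nu>3) / (\<ff> - \<kappa>1 / \<nu>7))) \<gg>"
    by (rule rat_val_eq, (rule intros | use nonzero in simp)+)
  ultimately show "rat_val const ?\<sigma> (?\<sigma> v) (X v)"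
    by (cases v) (auto intro: rat_val_eq[OF rat_val_X[OF field_hom_const]])
qed

lemma field_hom_s3: "field_hom s3"
  unfolding s3_def
proof (rule field_hom_subst)
  fix v
  let ?\<sigma> = "X(N1 := \<kappa>2 / \<nu>5, N5 := \<kappa>2 / \<nu>1, K1 := \<kappa>1 * \<kappa>2 / (\<nu>1 * \<nu>5),
                 VF := \<ff> * ((\<gg> - 1 / \<nu>1) / (\<gg> - \<nu>5 / \<kappa>2)))"
  note intros = rat_val_mult[OF field_hom_const] rat_val_divide[OF field_hom_const]
    rat_val_diff[OF field_hom_const] rat_val_X[OF field_hom_const] rat_val_1[OF field_hom_const]
  note nonzero = g_minus_inverse_nu1_nonzero g_minus_nu5_kappa2_nonzero
  have "rat_val const ?\<sigma> (\<kappa>2 / \<nu>5) \<nu>1"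
    by (rule rat_val_eq, (rule intros | simp)+)
  moreover have "rat_val const ?\<sigma> (\<kappa>2 / \<nu>1) \<nu>5"
    by (rule rat_val_eq, (rule intros | simp)+)
  moreover have "rat_val const ?\<sigma> (\<kappa>1 * \<kappa>2 / (\<nu>1 * \<nu>5)) \<kappa>1"
    by (rule rat_val_eq, (rule intros | simp)+)
  moreover have "rat_val const ?\<sigma> (\<ff> * ((\<gg> - 1 / \<nu>1) / (\<gg> - \<nu>5 / \<kappa>2))) \<ff>"
    by (rule rat_val_eq, (rule intros | use nonzero in simp)+)
  ultimately show "rat_val const ?\<sigma> (?\<sigma> v) (X v)"
    by (cases v) (auto intro: rat_val_eq[OF rat_val_X[OF field_hom_const]])
qed

lemma field_hom_comp: "field_hom h \<Longrightarrow> field_hom k \<Longrightarrow> field_hom (h \<circ> k)"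
  by (simp add: field_hom_def)

interpretation s0: field_hom s0 by (rule field_hom_s0)
interpretation s1: field_hom s1 by (rule field_hom_s1)
interpretation s2: field_hom s2 by (rule field_hom_s2)
interpretation s3: field_hom s3 by (rule field_hom_s3)
interpretation s5: field_hom s5 by (rule field_hom_s5)

lemma generator_X:
  "s0 (X v) = (X(N7 := \<nu>8, N8 := \<nu>7)) v"
  "s1 (X v) = (X(N3 := \<nu>4, N4 := \<nu>3)) v"
  "s2 (X v) = (X(N3 := \<kappa>1 / \<nu>7, N7 := \<kappa>1 / \<nu>3, K2 := \<kappa>1 * \<kappa>2 / (\<nu>3 * \<nu>7),
                 VG := \<gg> * ((\<ff> - \<nu>3) / (\<ff> - \<kappa>1 / \<nu>7)))) v"
  "s3 (X v) = (X(N1 := \<kappa>2 / \<nu>5, N5 := \<kappa>2 / \<nu>1, K1 := \<kappa>1 * \<kappa>2 / (\<nu>1 * \<nu>5),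
                 VF := \<ff> * ((\<gg> - 1 / \<nu>1) / (\<gg> - \<nu>5 / \<kappa>2)))) v"
  "s5 (X v) = (X(N5 := \<nu>6, N6 := \<nu>5)) v"
  by (simp_all only: s0_def s1_def s2_def s3_def s5_def subst_X)

definition conj_s2 :: "wfield \<Rightarrow> wfield" where
  "conj_s2 = s2 \<circ> s1 \<circ> s0 \<circ> s2"

lemma conj_s2_eq: "conj_s2 r = s2 (s1 (s0 (s2 r)))"
  by (simp add: conj_s2_def)

interpretation conj_s2: field_hom conj_s2
  unfolding conj_s2_def by (intro field_hom_comp field_hom_s0 field_hom_s1 field_hom_s2)

definition E_W :: wfield where
  "E_W = (\<ff> - \<nu>3) * (\<ff> - \<nu>4) / ((\<ff> - \<kappa>1 / \<nu>7) * (\<ff> - \<kappa>1 / \<nu>8))"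

lemma conj_s2_X:
  "conj_s2 (X v) = (X(N3 := \<kappa>1 / \<nu>8, N8 := \<kappa>1 / \<nu>3, N4 := \<kappa>1 / \<nu>7, N7 := \<kappa>1 / \<nu>4,
     K2 := \<kappa>1^2 * \<kappa>2 / (\<nu>3 * \<nu>4 * \<nu>7 * \<nu>8), VG := E_W * \<gg>)) v"
  by (cases v) (simp_all add: conj_s2_eq generator_X E_W_def power2_eq_square mult_ac)

text \<open>The right-hand factor of the word has \<open>s0\<close> and \<open>s1\<close> in the
  opposite order to \<open>conj_s2\<close>. Recomputing the images of the variables avoids a proof
  that the two maps commute on the whole field.\<close>

lemma inner_conj_s2_X:
  "s2 (s0 (s1 (s2 (X v)))) = (X(N3 := \<kappa>1 / \<nu>8, N8 := \<kappa>1 / \<nu>3, N4 := \<kappa>1 / \<nu>7, N7 := \<kappa>1 / \<nu>4,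
     K2 := \<kappa>1^2 * \<kappa>2 / (\<nu>3 * \<nu>4 * \<nu>7 * \<nu>8), VG := E_W * \<gg>)) v"
  by (cases v) (simp_all add: generator_X E_W_def power2_eq_square mult_ac)

definition word_W :: "wfield \<Rightarrow> wfield" where
  "word_W = s5 \<circ> s2 \<circ> s1 \<circ> s0 \<circ> s2 \<circ> s3 \<circ> s2 \<circ> s0 \<circ> s1 \<circ> s2"

lemma word_W_eq: "word_W r = s5 (conj_s2 (s3 (s2 (s0 (s1 (s2 r))))))"
  by (simp add: word_W_def conj_s2_def)

lemma field_hom_word_W: "field_hom word_W"
  unfolding word_W_def
  by (intro field_hom_comp field_hom_s0 field_hom_s1 field_hom_s2 field_hom_s3 field_hom_s5)

interpretation word_W: field_hom word_W by (rule field_hom_word_W)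

text \<open>This is q^lambda = q \<nu>2 \<nu>5 / \<kappa>2 with q eliminated by the constraint,
  which cancels \<nu>2 and \<nu>5.\<close>

definition rho_W :: wfield where
  "rho_W = \<kappa>1^2 * \<kappa>2 / (\<nu>1 * \<nu>3 * \<nu>4 * \<nu>6 * \<nu>7 * \<nu>8)"

lemma rho_W_eq: "rho_W = q_W * \<nu>2 * \<nu>5 / \<kappa>2"
  by (simp add: rho_W_def q_W_def power2_eq_square field_simps)

definition f_W :: wfield where
  "f_W = (E_W * \<gg> - 1 / \<nu>1) / (E_W * \<gg> - 1 / (rho_W * \<nu>1)) * \<ff>"

definition g_W :: wfield where
  "g_W = E_W * ((f_W - \<kappa>1 / \<nu>7) * (f_W - \<kappa>1 / \<nu>8) /
                ((f_W - rho_W * \<nu>3) * (f_W - rho_W * \<nu>4))) * \<gg>"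

lemma s5_E_W: "s5 E_W = E_W"
  by (simp add: E_W_def generator_X)

text \<open>The inner conjugate fixes \<open>\<ff>\<close>, so only \<open>s3\<close> moves it. The
  outer conjugate then turns \<open>\<gg>\<close> into \<open>E_W * \<gg>\<close> and rescales
  \<open>\<kappa>2\<close>, and \<open>s5\<close> puts \<open>\<nu>6\<close> for
  \<open>\<nu>5\<close>; this is how \<open>rho_W\<close> enters the denominator.\<close>

lemma word_W_f: "word_W \<ff> = f_W"
proof -
  have "s2 (s0 (s1 (s2 \<ff>))) = \<ff>" by (simp add: inner_conj_s2_X)
  then have "word_W \<ff> = \<ff> * ((E_W * \<gg> - 1 / \<nu>1) / (E_W * \<gg> - \<nu>6 * (\<nu>3 * \<nu>4 * \<nu>7 * \<nu>8) / (\<kappa>1^2 * \<kappa>2)))"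
    by (simp add: word_W_eq generator_X conj_s2_X s5_E_W)
  also have "\<nu>6 * (\<nu>3 * \<nu>4 * \<nu>7 * \<nu>8) / (\<kappa>1^2 * \<kappa>2) = 1 / (rho_W * \<nu>1)"
    by (simp add: rho_W_def field_simps)
  finally show ?thesis by (simp add: f_W_def)
qed

text \<open>The inner conjugate gives \<open>E_W * \<gg>\<close>, and the rest of the word acts on
  each factor. It sends \<open>\<nu>3\<close>, \<open>\<nu>4\<close> to the old poles of
  \<open>E_W\<close>, and those poles to \<open>rho_W\<close> times the old zeros; the factor
  \<open>rho_W\<close> stems from the image of \<open>\<kappa>1\<close> under
  \<open>s3\<close>.\<close>

lemma word_W_g:
  "word_W \<gg> = g_W"
proof -
  let ?h = "\<lambda>r. s5 (conj_s2 (s3 r))"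
  have f: "?h \<ff> = f_W"
    using word_W_f by (simp add: word_W_eq inner_conj_s2_X)
  have g: "?h \<gg> = E_W * \<gg>"
    by (simp add: generator_X conj_s2_X s5_E_W)
  have 3: "?h \<nu>3 = \<kappa>1 / \<nu>8" and 4: "?h \<nu>4 = \<kappa>1 / \<nu>7"
    by (simp_all add: generator_X conj_s2_X)
  have 7: "?h (\<kappa>1 / \<nu>7) = rho_W * \<nu>4" and 8: "?h (\<kappa>1 / \<nu>8) = rho_W * \<nu>3"
    by (simp_all add: generator_X conj_s2_X rho_W_def field_simps power2_eq_square)
  have "word_W \<gg> = ?h ((\<ff> - \<nu>3) * (\<ff> - \<nu>4) / ((\<ff> - \<kappa>1 / \<nu>7) * (\<ff> - \<kappa>1 / \<nu>8)) * \<gg>)"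
    by (simp add: word_W_eq inner_conj_s2_X E_W_def)
  also have "\<dots> = (?h \<ff> - ?h \<nu>3) * (?h \<ff> - ?h \<nu>4)
      / ((?h \<ff> - ?h (\<kappa>1 / \<nu>7)) * (?h \<ff> - ?h (\<kappa>1 / \<nu>8))) * ?h \<gg>"
    by (simp only: s3.hom_mult s3.hom_divide s3.hom_diff conj_s2.hom_mult conj_s2.hom_divide
        conj_s2.hom_diff s5.hom_mult s5.hom_divide s5.hom_diff)
  also have "\<dots> = g_W"
    unfolding f g 3 4 7 8 g_W_def by (simp add: mult_ac)
  finally show ?thesis .
qed

lemma word_W_X:
  "word_W (X v) = (case v of
     K1 \<Rightarrow> rho_W * \<kappa>1 | K2 \<Rightarrow> rho_W^2 * \<kappa>2 | N1 \<Rightarrow> rho_W * \<nu>1 | N2 \<Rightarrow> \<nu>2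
   | N3 \<Rightarrow> rho_W * \<nu>3 | N4 \<Rightarrow> rho_W * \<nu>4 | N5 \<Rightarrow> rho_W * \<nu>6 | N6 \<Rightarrow> \<nu>5
   | N7 \<Rightarrow> rho_W * \<nu>7 | N8 \<Rightarrow> rho_W * \<nu>8 | VF \<Rightarrow> f_W | VG \<Rightarrow> g_W)"
proof (cases v)
  case VF
  then show ?thesis by (simp add: word_W_f)
next
  case VG
  then show ?thesis by (simp add: word_W_g)
qed (simp_all add: word_W_eq inner_conj_s2_X generator_X conj_s2_X rho_W_def field_simps
    eval_nat_numeral)

section \<open>The middle convolution of rank-one residues\<close>

lemma sum_3_2:
  fixes f :: "3 \<times> 2 \<Rightarrow> 'a::comm_monoid_add"
  shows "sum f UNIV = f (1,1) + f (1,2) + (f (2,1) + f (2,2)) + (f (3,1) + f (3,2))"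
proof -
  have "sum f UNIV = (\<Sum>i\<in>UNIV. \<Sum>k\<in>UNIV. f (i, k))"
    by (simp add: sum.cartesian_product)
  then show ?thesis by (simp add: sum_2 sum_3)
qed

definition rank_one :: "complex \<Rightarrow> complex \<Rightarrow> complex \<Rightarrow> complex^2^2" where
  "rank_one m p r = vector [vector [p, r], vector [m * p, m * r]]"

lemma rank_one_nth [simp]:
  "rank_one m p r $ 1 $ 1 = p" "rank_one m p r $ 1 $ 2 = r"
  "rank_one m p r $ 2 $ 1 = m * p" "rank_one m p r $ 2 $ 2 = m * r"
  by (simp_all add: rank_one_def vector_2)

lemma mat_2_nth [simp]:
  "(mat c :: complex^2^2) $ 1 $ 1 = c" "(mat c :: complex^2^2) $ 1 $ 2 = 0"
  "(mat c :: complex^2^2) $ 2 $ 1 = 0" "(mat c :: complex^2^2) $ 2 $ 2 = c"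
  by (simp_all add: mat_def)

lemma diag2_nth [simp]:
  "diag2 a b $ 1 $ 1 = a" "diag2 a b $ 1 $ 2 = 0" "diag2 a b $ 2 $ 1 = 0" "diag2 a b $ 2 $ 2 = b"
  by (simp_all add: diag2_def vector_2)

text \<open>The four sums state that B_0 + B_1 + B_2 = I - B_infinity is diagonal with entries
  \<open>d1\<close> = 1 - chi_1 t a_1 a_2 / theta_1 and \<open>d2\<close> = 1 - q^lambda.\<close>

locale rank_one_residues =
  fixes m0 m1 m2 p0 p1 p2 r0 r1 r2 d1 d2 :: complex
  assumes sum_p: "p0 + p1 + p2 = d1"
    and sum_r: "r0 + r1 + r2 = 0"
    and sum_mp: "m0 * p0 + m1 * p1 + m2 * p2 = 0"
    and sum_mr: "m0 * r0 + m1 * r1 + m2 * r2 = d2"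
    and d1: "d1 \<noteq> 0" and d2: "d2 \<noteq> 0" and d12: "d1 \<noteq> d2"
    and r0: "r0 \<noteq> 0" and r1: "r1 \<noteq> 0" and r2: "r2 \<noteq> 0"
begin

text \<open>
  A block vector is recorded by the three numbers \<open>phi i v\<close>, which vanish exactly on
  $\mathcal K$ and send $\mathcal L$ to the line of $r = (r_0,r_1,r_2)$.  Here $c = p \times r$ and
  $n = (1,1,1) \times m$, so that \<open>proj1\<close> and \<open>proj2\<close> form a basis of the linear forms in
  the \<open>phi i v\<close> which annihilate $r$.
\<close>

definition "c0 = p1 * r2 - p2 * r1"
definition "c1 = p2 * r0 - p0 * r2"
definition "c2 = p0 * r1 - p1 * r0"
definition "n0 = m2 - m1"
definition "n1 = m0 - m2"
definition "n2 = m1 - m0"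

definition "phi0 v = p0 * v $ (1::3, 1::2) + r0 * v $ (1, 2)"
definition "phi1 v = p1 * v $ (2::3, 1::2) + r1 * v $ (2, 2)"
definition "phi2 v = p2 * v $ (3::3, 1::2) + r2 * v $ (3, 2)"

definition "proj1 v = phi0 v + phi1 v + phi2 v"
definition "proj2 v = c0 * phi0 v + c1 * phi1 v + c2 * phi2 v"

definition "al1 = (d1 - d2) * p1 / d1"
definition "al2 = (d1 - d2) * p2 / d1"
definition "be1 = - n1 / d1"
definition "be2 = - n2 / d1"

lemmas proj_defs = proj1_def proj2_def phi0_def phi1_def phi2_def

lemma proj_combination:
  "proj1 (v - (\<Sum>i\<in>UNIV. c $ i *s e i)) = proj1 v - (c $ 1 * proj1 (e 1) + c $ (2::2) * proj1 (e 2))"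
  "proj2 (v - (\<Sum>i\<in>UNIV. c $ i *s e i)) = proj2 v - (c $ 1 * proj2 (e 1) + c $ (2::2) * proj2 (e 2))"
  by (simp_all add: proj_defs sum_2 algebra_simps)

text \<open>With w_i = \<open>phi i v\<close>, each left side is the new i-th coordinate after the
  i-th convolution block acts. It vanishes at w = r, hence is a combination of the two forms
  annihilating r. The coefficients are found at w = p, where the second form vanishes, and at w = n,
  where the first form and m . n vanish.\<close>

lemma form_identities:
  "p1 * (w0 + w1 + w2) + r1 * (m0 * w0 + m1 * w1 + m2 * w2) - d2 * w1
     = al1 * (w0 + w1 + w2) + be1 * (c0 * w0 + c1 * w1 + c2 * w2)"
  "p2 * (w0 + w1 + w2) + r2 * (m0 * w0 + m1 * w1 + m2 * w2) - d2 * w2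
     = al2 * (w0 + w1 + w2) + be2 * (c0 * w0 + c1 * w1 + c2 * w2)"
  "p0 * (w0 + w1 + w2) + r0 * (m0 * w0 + m1 * w1 + m2 * w2) - d2 * w0
     = (d1 - d2) * p0 / d1 * (w0 + w1 + w2) + (- n0 / d1) * (c0 * w0 + c1 * w1 + c2 * w2)"
proof -
  \<comment> \<open>One statement in neutral letters; its three cyclic relabellings give the three
    identities with the denominator \<open>d1\<close> cleared.\<close>
  have cofactors: "d1 * (p * (w' + w + w'') + r * (m' * w' + m * w + m'' * w'') - d2 * w)
     = (d1 - d2) * p * (w' + w + w'')
        - (m' - m'') * ((p * r'' - p'' * r) * w' + (p'' * r' - p' * r'') * w + (p' * r - p * r') * w'')"
    if "p' + p + p'' = d1" "r' + r + r'' = 0" "m' * p' + m * p + m'' * p'' = 0"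
      "m' * r' + m * r + m'' * r'' = d2"
    for p r p' p'' r' r'' m m' m'' w w' w'' :: complex
  proof -
    \<comment> \<open>With \<open>d1\<close> and \<open>d2\<close> written out as sums this is a
      polynomial identity whose right side is a combination of the two vanishing sums.\<close>
    have "(p' + p + p'') * (p * (w' + w + w'') + r * (m' * w' + m * w + m'' * w'') - (m' * r' + m * r + m'' * r'') * w)
     - ((p' + p + p'' - (m' * r' + m * r + m'' * r'')) * p * (w' + w + w'')
        - (m' - m'') * ((p * r'' - p'' * r) * w' + (p'' * r' - p' * r'') * w + (p' * r - p * r') * w''))
     = (m' * p' + m * p + m'' * p'') * (r * (w' + w + w'') - (r' + r + r'') * w)
        + (r' + r + r'') * p * (m' * w' + m * w + m'' * w'')"
      by (simp add: algebra_simps)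
    then show ?thesis unfolding that by simp
  qed
  have *: "d1 * (p1 * (w0 + w1 + w2) + r1 * (m0 * w0 + m1 * w1 + m2 * w2) - d2 * w1)
     = (d1 - d2) * p1 * (w0 + w1 + w2) - n1 * (c0 * w0 + c1 * w1 + c2 * w2)"
    "d1 * (p2 * (w0 + w1 + w2) + r2 * (m0 * w0 + m1 * w1 + m2 * w2) - d2 * w2)
     = (d1 - d2) * p2 * (w0 + w1 + w2) - n2 * (c0 * w0 + c1 * w1 + c2 * w2)"
    "d1 * (p0 * (w0 + w1 + w2) + r0 * (m0 * w0 + m1 * w1 + m2 * w2) - d2 * w0)
     = (d1 - d2) * p0 * (w0 + w1 + w2) - n0 * (c0 * w0 + c1 * w1 + c2 * w2)"
    using cofactors[of p0 p1 p2 r0 r1 r2 m0 m1 m2 w0 w1 w2]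
      cofactors[of p1 p2 p0 r1 r2 r0 m1 m2 m0 w1 w2 w0]
      cofactors[of p2 p0 p1 r2 r0 r1 m2 m0 m1 w2 w0 w1] sum_p sum_r sum_mp sum_mr
    unfolding n0_def n1_def n2_def c0_def c1_def c2_def by (simp_all add: ac_simps)
  show "p1 * (w0 + w1 + w2) + r1 * (m0 * w0 + m1 * w1 + m2 * w2) - d2 * w1
     = al1 * (w0 + w1 + w2) + be1 * (c0 * w0 + c1 * w1 + c2 * w2)"
    using *(1) d1 by (simp add: al1_def be1_def divide_simps mult.commute)
  show "p2 * (w0 + w1 + w2) + r2 * (m0 * w0 + m1 * w1 + m2 * w2) - d2 * w2
     = al2 * (w0 + w1 + w2) + be2 * (c0 * w0 + c1 * w1 + c2 * w2)"
    using *(2) d1 by (simp add: al2_def be2_def divide_simps mult.commute)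
  show "p0 * (w0 + w1 + w2) + r0 * (m0 * w0 + m1 * w1 + m2 * w2) - d2 * w0
     = (d1 - d2) * p0 / d1 * (w0 + w1 + w2) + (- n0 / d1) * (c0 * w0 + c1 * w1 + c2 * w2)"
    using *(3) d1 by (simp add: divide_simps mult.commute)
qed

abbreviation "B0 \<equiv> rank_one m0 p0 r0"
abbreviation "B1 \<equiv> rank_one m1 p1 r1"
abbreviation "B2 \<equiv> rank_one m2 p2 r2"

definition F1 :: "complex^(3 \<times> 2)^(3 \<times> 2)" where
  "F1 = block_matrix (vector [vector [0, 0, 0], vector [B0, B1 - mat d2, B2], vector [0, 0, 0]])"

definition F2 :: "complex^(3 \<times> 2)^(3 \<times> 2)" where
  "F2 = block_matrix (vector [vector [0, 0, 0], vector [0, 0, 0], vector [B0, B1, B2 - mat d2]])"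

definition Fhat :: "complex^(3 \<times> 2)^(3 \<times> 2)" where
  "Fhat = block_matrix (vector [vector [B0, B1, B2], vector [B0, B1, B2], vector [B0, B1, B2]])"

definition K :: "(complex^(3 \<times> 2)) set" where
  "K = {v. B0 *v block v 1 = 0 \<and> B1 *v block v 2 = 0 \<and> B2 *v block v 3 = 0}"

definition L :: "(complex^(3 \<times> 2)) set" where
  "L = {v. (Fhat - mat d2) *v v = 0}"

lemmas nth_simps = matrix_vector_mult_def sum_3_2 block_matrix_def vector_3 sum_2 block_def

lemma mem_K: "v \<in> K \<longleftrightarrow> phi0 v = 0 \<and> phi1 v = 0 \<and> phi2 v = 0"
proof -
  have "m * p * a + m * r * b = m * (p * a + r * b)" for m p r a b :: complex
    by (simp add: algebra_simps)
  then show ?thesis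
    by (auto simp: K_def vec_eq_iff forall_2 nth_simps phi0_def phi1_def phi2_def)
qed

lemma Fhat_nth:
  "(Fhat *v v) $ (i, 1) = proj1 v"
  "(Fhat *v v) $ (i, 2) = m0 * phi0 v + m1 * phi1 v + m2 * phi2 v"
proof -
  have "i = 1 \<or> i = 2 \<or> i = 3" using exhaust_3 by blast
  then show "(Fhat *v v) $ (i, 1) = proj1 v"
    "(Fhat *v v) $ (i, 2) = m0 * phi0 v + m1 * phi1 v + m2 * phi2 v"
    by (auto simp: nth_simps Fhat_def proj_defs algebra_simps)
qed

lemma mem_L: "v \<in> L \<longleftrightarrow> (\<forall>i. proj1 v = d2 * v $ (i, 1) \<and>
   m0 * phi0 v + m1 * phi1 v + m2 * phi2 v = d2 * v $ (i, 2))"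
proof -
  have [simp]: "(mat d2 :: complex^(3\<times>2)^(3\<times>2)) *v v = d2 *s v"
    by (simp add: vec_eq_iff matrix_vector_mult_def mat_def if_distrib[of "\<lambda>x. x * _"] cong: if_cong)
  have "v \<in> L \<longleftrightarrow> (\<forall>i k. (Fhat *v v) $ (i, k) = d2 * v $ (i, k))"
    by (simp add: L_def matrix_vector_mult_diff_rdistrib vec_eq_iff split_paired_All)
  then show ?thesis by (simp add: forall_2 Fhat_nth)
qed

lemma KL_eq: "{u + v | u v. u \<in> K \<and> v \<in> L} = {v. proj1 v = 0 \<and> proj2 v = 0}"
proof (intro set_eqI iffI)
  fix w assume "w \<in> {u + v | u v. u \<in> K \<and> v \<in> L}"
  then obtain u v where w: "w = u + v" and u: "u \<in> K" and v: "v \<in> L" by blast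
  have phi: "phi0 w = phi0 v" "phi1 w = phi1 v" "phi2 w = phi2 v"
    using u by (simp_all add: w mem_K phi0_def phi1_def phi2_def algebra_simps)
  let ?a = "v $ (1, 1)" and ?b = "v $ (1, 2)"
  have eq: "v $ (2, 1) = ?a" "v $ (3, 1) = ?a" "v $ (2, 2) = ?b" "v $ (3, 2) = ?b"
    using v d2 unfolding mem_L by (metis mult_cancel_left)+
  \<comment> \<open>On three equal blocks \<open>proj1\<close> has the value \<open>d2 * ?a\<close>
    by the eigenvector equation and \<open>d1 * ?a\<close> by the column sums, and \<open>d1\<close>
    differs from \<open>d2\<close>.\<close>
  have "proj1 v = d2 * ?a" using v by (simp add: mem_L)
  moreover have "proj1 v = (p0 + p1 + p2) * ?a + (r0 + r1 + r2) * ?b"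
    by (simp add: proj_defs eq algebra_simps)
  ultimately have a: "?a = 0" using d12 by (simp add: sum_p sum_r)
  have "proj1 v = (r0 + r1 + r2) * ?b"
    by (simp add: proj_defs eq a algebra_simps)
  then have "proj1 v = 0" by (simp add: sum_r)
  moreover have "proj2 v = 0"
    by (simp add: proj_defs eq a c0_def c1_def c2_def algebra_simps)
  ultimately
  show "w \<in> {v. proj1 v = 0 \<and> proj2 v = 0}" by (simp add: proj1_def proj2_def phi)
next
  fix w assume "w \<in> {v. proj1 v = 0 \<and> proj2 v = 0}"
  then have w: "phi0 w + phi1 w + phi2 w = 0" "c0 * phi0 w + c1 * phi1 w + c2 * phi2 w = 0"
    by (simp_all add: proj1_def proj2_def)
  \<comment> \<open>With both forms zero, the form identities reduce to d2 phi_i = r_i (m . phi), so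
    the coordinates are \<open>s\<close> times r.\<close>
  define s where "s = (m0 * phi0 w + m1 * phi1 w + m2 * phi2 w) / d2"
  have phi: "phi0 w = r0 * s" "phi1 w = r1 * s" "phi2 w = r2 * s"
    using form_identities[of "phi0 w" "phi1 w" "phi2 w", unfolded w] d2
    by (simp_all add: s_def eq_divide_eq mult.commute)
  \<comment> \<open>Three equal blocks (0, s) have coordinates \<open>s\<close> times r and form an
    element of \<open>L\<close>.\<close>
  define v :: "complex^(3\<times>2)" where "v = (\<chi> a. if snd a = 1 then 0 else s)"
  have pv: "phi0 v = r0 * s" "phi1 v = r1 * s" "phi2 v = r2 * s"
    by (simp_all add: phi0_def phi1_def phi2_def v_def)
  have "proj1 v = (r0 + r1 + r2) * s" by (simp add: proj1_def pv algebra_simps)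
  moreover have "m0 * phi0 v + m1 * phi1 v + m2 * phi2 v = (m0 * r0 + m1 * r1 + m2 * r2) * s"
    unfolding pv by (simp add: algebra_simps)
  ultimately have "v \<in> L"
    unfolding mem_L by (simp add: sum_r sum_mr) (simp add: v_def)
  moreover have "w - v \<in> K"
    unfolding mem_K using phi pv by (simp add: phi0_def phi1_def phi2_def algebra_simps)
  ultimately show "w \<in> {u + v | u v. u \<in> K \<and> v \<in> L}"
    by (metis (mono_tags, lifting) diff_add_cancel mem_Collect_eq)
qed

text \<open>The image of \<open>F1\<close> lies in a single block, where the forms
  \<open>proj1\<close> and \<open>proj2\<close> have coefficients 1 and \<open>c1\<close>; hence the
  induced map has rank at most one.\<close>

lemma proj_F1:
  "proj1 (F1 *v v) = al1 * proj1 v + be1 * proj2 v"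
  "proj2 (F1 *v v) = c1 * (al1 * proj1 v + be1 * proj2 v)"
proof -
  have phi: "phi0 (F1 *v v) = 0" "phi2 (F1 *v v) = 0"
    "phi1 (F1 *v v) = p1 * (phi0 v + phi1 v + phi2 v)
       + r1 * (m0 * phi0 v + m1 * phi1 v + m2 * phi2 v) - d2 * phi1 v"
    by (simp_all add: F1_def phi0_def phi1_def phi2_def nth_simps) (simp add: algebra_simps)
  show "proj1 (F1 *v v) = al1 * proj1 v + be1 * proj2 v"
    "proj2 (F1 *v v) = c1 * (al1 * proj1 v + be1 * proj2 v)"
    using form_identities(1)[of "phi0 v" "phi1 v" "phi2 v"] by (simp_all add: proj1_def proj2_def phi)
qed

lemma proj_F2:
  "proj1 (F2 *v v) = al2 * proj1 v + be2 * proj2 v"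
  "proj2 (F2 *v v) = c2 * (al2 * proj1 v + be2 * proj2 v)"
proof -
  have phi: "phi0 (F2 *v v) = 0" "phi1 (F2 *v v) = 0"
    "phi2 (F2 *v v) = p2 * (phi0 v + phi1 v + phi2 v)
       + r2 * (m0 * phi0 v + m1 * phi1 v + m2 * phi2 v) - d2 * phi2 v"
    by (simp_all add: F2_def phi0_def phi1_def phi2_def nth_simps) (simp add: algebra_simps)
  show "proj1 (F2 *v v) = al2 * proj1 v + be2 * proj2 v"
    "proj2 (F2 *v v) = c2 * (al2 * proj1 v + be2 * proj2 v)"
    using form_identities(2)[of "phi0 v" "phi1 v" "phi2 v"] by (simp_all add: proj1_def proj2_def phi)
qed

text \<open>All blocks of \<open>Fhat *v v\<close> equal (proj1 v, m . phi). On such vectors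
  \<open>proj1\<close> is \<open>d1\<close> times the first component, by the sums of p and r, and
  \<open>proj2\<close> vanishes because c = p x r is orthogonal to p and r.\<close>

lemma proj_Finf:
  "proj1 ((mat 1 - Fhat) *v v) = (1 - d1) * proj1 v"
  "proj2 ((mat 1 - Fhat) *v v) = proj2 v"
proof -
  define s where "s = m0 * phi0 v + m1 * phi1 v + m2 * phi2 v"
  have nth: "((mat 1 - Fhat) *v v) $ (i, 1) = v $ (i, 1) - proj1 v"
    "((mat 1 - Fhat) *v v) $ (i, 2) = v $ (i, 2) - s" for i
    by (simp_all add: matrix_vector_mult_diff_rdistrib Fhat_nth s_def)
  have "proj1 ((mat 1 - Fhat) *v v) = proj1 v - (p0 + p1 + p2) * proj1 v - (r0 + r1 + r2) * s"
  proof -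
    have "proj1 ((mat 1 - Fhat) *v v) = p0 * (v $ (1, 1) - proj1 v) + r0 * (v $ (1, 2) - s)
        + (p1 * (v $ (2, 1) - proj1 v) + r1 * (v $ (2, 2) - s))
        + (p2 * (v $ (3, 1) - proj1 v) + r2 * (v $ (3, 2) - s))"
      unfolding proj_defs[of "(mat 1 - Fhat) *v v"] nth by (rule refl)
    also have "\<dots> = phi0 v + phi1 v + phi2 v - (p0 + p1 + p2) * proj1 v - (r0 + r1 + r2) * s"
      by (simp add: phi0_def phi1_def phi2_def algebra_simps)
    finally show ?thesis by (simp add: proj1_def)
  qed
  then show "proj1 ((mat 1 - Fhat) *v v) = (1 - d1) * proj1 v"
    unfolding sum_p sum_r by (simp add: left_diff_distrib)
  show "proj2 ((mat 1 - Fhat) *v v) = proj2 v"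
    unfolding proj_defs(2-)[of "(mat 1 - Fhat) *v v"] nth
    by (simp add: proj2_def phi0_def phi1_def phi2_def c0_def c1_def c2_def algebra_simps)
qed

lemma proj_surj: "\<exists>v. proj1 v = a \<and> proj2 v = b"
proof -
  \<comment> \<open>The combination (a / d1) p + (b / (d1 d2)) n: the vectors p and n are dual to
    the two forms up to the factors d1 and d1 d2.\<close>
  define w0 where "w0 = a * p0 / d1 + b * n0 / (d1 * d2)"
  define w1 where "w1 = a * p1 / d1 + b * n1 / (d1 * d2)"
  define w2 where "w2 = a * p2 / d1 + b * n2 / (d1 * d2)"
  define v :: "complex^(3\<times>2)" where
    "v = (\<chi> x. if snd x = 1 then 0 else if fst x = 1 then w0 / r0 else if fst x = 2 then w1 / r1 else w2 / r2)"
  have phi: "phi0 v = w0" "phi1 v = w1" "phi2 v = w2"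
    using r0 r1 r2 by (simp_all add: phi0_def phi1_def phi2_def v_def)
  have "n0 + n1 + n2 = 0" by (simp add: n0_def n1_def n2_def)
  moreover have "w0 + w1 + w2 = a * (p0 + p1 + p2) / d1 + b * (n0 + n1 + n2) / (d1 * d2)"
    by (simp add: w0_def w1_def w2_def ring_distribs add_divide_distrib)
  ultimately have "proj1 v = a" using d1 by (simp add: proj1_def phi sum_p)
  moreover have "c0 * p0 + c1 * p1 + c2 * p2 = 0"
    by (simp add: c0_def c1_def c2_def algebra_simps)
  moreover have "c0 * n0 + c1 * n1 + c2 * n2 = d1 * d2"
  proof -
    \<comment> \<open>Lagrange's identity (u . p)(m . r) - (m . p)(u . r) = (p x r) . (u x m) for u
      = (1,1,1).\<close>
    have "(p0 + p1 + p2) * (m0 * r0 + m1 * r1 + m2 * r2) - (m0 * p0 + m1 * p1 + m2 * p2) * (r0 + r1 + r2)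
        = c0 * n0 + c1 * n1 + c2 * n2"
      unfolding n0_def n1_def n2_def c0_def c1_def c2_def by (simp add: algebra_simps)
    then show ?thesis by (simp add: sum_p sum_r sum_mp sum_mr)
  qed
  moreover have "c0 * w0 + c1 * w1 + c2 * w2
      = a * (c0 * p0 + c1 * p1 + c2 * p2) / d1 + b * (c0 * n0 + c1 * n1 + c2 * n2) / (d1 * d2)"
    by (simp add: w0_def w1_def w2_def ring_distribs add_divide_distrib mult_ac)
  ultimately show ?thesis using d1 d2 by (intro exI[of _ v]) (simp add: proj2_def phi)
qed

abbreviation "S \<equiv> {u + v | u v. u \<in> K \<and> v \<in> L}"

lemma induces_iff:
  "induces S e F M \<longleftrightarrow>
     proj1 (F *v e 1) = M $ 1 $ 1 * proj1 (e 1) + M $ 2 $ 1 * proj1 (e 2) \<and>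
     proj2 (F *v e 1) = M $ 1 $ 1 * proj2 (e 1) + M $ 2 $ 1 * proj2 (e 2) \<and>
     proj1 (F *v e 2) = M $ 1 $ 2 * proj1 (e 1) + M $ 2 $ 2 * proj1 (e 2) \<and>
     proj2 (F *v e 2) = M $ 1 $ 2 * proj2 (e 1) + M $ 2 $ 2 * proj2 (e 2)"
proof -
  have "proj1 (F *v e j - (\<Sum>i\<in>UNIV. M $ i $ j *s e i))
      = proj1 (F *v e j) - (M $ 1 $ j * proj1 (e 1) + M $ 2 $ j * proj1 (e 2))"
    "proj2 (F *v e j - (\<Sum>i\<in>UNIV. M $ i $ j *s e i))
      = proj2 (F *v e j) - (M $ 1 $ j * proj2 (e 1) + M $ 2 $ j * proj2 (e 2))" for j
    using proj_combination[of "F *v e j" "\<chi> i. M $ i $ j" e] by simp_all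
  then show ?thesis unfolding induces_def KL_eq by (auto simp: forall_2)
qed

lemma exists_diagonalizing_basis:
  "\<exists>e G1 G2. quotient_basis S e \<and> induces S e (mat 1 - Fhat) (diag2 (1 - d1) 1) \<and>
     induces S e F1 G1 \<and> induces S e F2 G2"
proof -
  \<comment> \<open>Representatives of the basis dual to the two forms; there the induced matrices
    can be read off.\<close>
  obtain u v where uv: "proj1 u = 1" "proj2 u = 0" "proj1 v = 0" "proj2 v = 1"
    using proj_surj by metis
  define e where "e = (\<lambda>i::2. if i = 1 then u else v)"
  have e: "e 1 = u" "e 2 = v" by (simp_all add: e_def)
  have "quotient_basis S e"
    unfolding quotient_basis_def KL_eq
  proof
    fix w
    have "w - (\<Sum>i\<in>UNIV. c $ i *s e i) \<in> {v. proj1 v = 0 \<and> proj2 v = 0}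
        \<longleftrightarrow> c = vector [proj1 w, proj2 w]" for c :: "complex^2"
      by (auto simp: proj_combination e uv vec_eq_iff forall_2 vector_2)
    then show "\<exists>!c :: complex^2. w - (\<Sum>i\<in>UNIV. c $ i *s e i) \<in> {v. proj1 v = 0 \<and> proj2 v = 0}"
      by simp
  qed
  moreover have "induces S e (mat 1 - Fhat) (diag2 (1 - d1) 1)"
    by (simp add: induces_iff proj_Finf e uv)
  moreover have "induces S e F1 (vector [vector [al1, be1], vector [c1 * al1, c1 * be1]])"
    by (simp add: induces_iff proj_F1 e uv vector_2)
  moreover have "induces S e F2 (vector [vector [al2, be2], vector [c2 * al2, c2 * be2]])"
    by (simp add: induces_iff proj_F2 e uv vector_2)
  ultimately show ?thesis by blast
qed

text \<open>
  A basis diagonalizing the action of $F_\infty$ is unique up to rescaling its members, since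
  the eigenvalues are distinct.
\<close>
lemma induced_matrices:
  assumes basis: "quotient_basis S e"
    and inf: "induces S e (mat 1 - Fhat) (diag2 (1 - d1) 1)"
    and G1: "induces S e F1 G1" and G2: "induces S e F2 G2"
  obtains k where "k \<noteq> 0"
    "G1 $ 1 $ 1 = al1" "G1 $ 1 $ 2 = k * be1" "G1 $ 2 $ 1 = c1 * al1 / k" "G1 $ 2 $ 2 = c1 * be1"
    "G2 $ 1 $ 1 = al2" "G2 $ 1 $ 2 = k * be2" "G2 $ 2 $ 1 = c2 * al2 / k" "G2 $ 2 $ 2 = c2 * be2"
proof -
  \<comment> \<open>The eigenvalues 1 - d1 and 1 differ, so each form vanishes on the eigenvector of
    the other eigenvalue.\<close>
  have off: "proj1 (e 2) = 0" "proj2 (e 1) = 0"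
    using inf d1 by (simp_all add: induces_iff proj_Finf)
  have span: "\<exists>c :: complex^2. proj1 v = c $ 1 * proj1 (e 1) \<and> proj2 v = c $ 2 * proj2 (e 2)" for v
  proof -
    obtain c where "v - (\<Sum>i\<in>UNIV. c $ i *s e i) \<in> S"
      using basis unfolding quotient_basis_def by blast
    then show ?thesis by (auto simp: KL_eq proj_combination off)
  qed
  obtain v where "proj1 v = 1" "proj2 v = 1" using proj_surj by blast
  with span[of v] have k: "proj1 (e 1) \<noteq> 0" "proj2 (e 2) \<noteq> 0" by auto
  show ?thesis
  \<comment> \<open>The ratio of the scales of the two basis vectors is the only freedom left; it
    affects the off-diagonal entries alone.\<close>
  proof (rule that[of "proj2 (e 2) / proj1 (e 1)"])
    show "proj2 (e 2) / proj1 (e 1) \<noteq> 0" using k by simp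
  qed (use G1 G2 k in \<open>auto simp: induces_iff proj_F1 proj_F2 off field_simps\<close>)
qed

end

section \<open>The parameters of the convolved system\<close>

text \<open>The \<open>r\<close> equations are the partial fractions of an upper right entry s x1 x2
  (x1 - x2) (x - y) / ((x - x1)(x - x2)). The left side of \<open>det_B\<close> is (x - x1)(x - x2)
  det B(x); the double poles are absent because B_1 and B_2 are singular.\<close>

locale lax_residues = rank_one_residues +
  fixes x1 x2 y s a3 a4 :: complex
  assumes x1: "x1 \<noteq> 0" and x2: "x2 \<noteq> 0" and x12: "x1 \<noteq> x2"
    and r0_eq: "r0 = s * (x1 - x2) * y"
    and r1_eq: "r1 = s * x2 * (y - x1)"
    and r2_eq: "r2 = - s * x1 * (y - x2)"
    and det_B: "\<And>x. (1 - d1) * (1 - d2) * ((x - x1) * (x - x2))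
        - x1 * (x - x2) * ((1 - d1) * (m1 * r1) + (1 - d2) * p1)
        - x2 * (x - x1) * ((1 - d1) * (m2 * r2) + (1 - d2) * p2)
        + x1 * x2 * ((m2 - m1) * (p1 * r2 - p2 * r1)) = (1 - d1) * (1 - d2) * (x - a3) * (x - a4)"
begin

text \<open>\<open>d1 * g12 x\<close> is the linear polynomial
  \<open>V * x - x1 * x2 * (m1 - m2)\<close>, so \<open>V\<close> is its slope and \<open>yt\<close>
  its zero.\<close>

definition "V = m0 * (x1 - x2) + m1 * x2 - m2 * x1"
definition "yt = x1 * x2 * (m1 - m2) / V"

text \<open>The entries of (x - x1)(x - x2) times the convolved Fuchsian matrix in the dual basis,
  that is for \<open>k\<close> = 1, written as polynomials so that they make sense at x1 and
  x2.\<close>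

definition "g11 x = (1 - d1) * ((x - x1) * (x - x2)) - x1 * (x - x2) * al1 - x2 * (x - x1) * al2"
definition "g12 x = - x1 * (x - x2) * be1 - x2 * (x - x1) * be2"
definition "g21 x = - x1 * (x - x2) * (c1 * al1) - x2 * (x - x1) * (c2 * al2)"
definition "g22 x = (x - x1) * (x - x2) - x1 * (x - x2) * (c1 * be1) - x2 * (x - x1) * (c2 * be2)"

text \<open>The form identities at coordinate vectors. The first two express the trace of each
  convolved residue as the trace of B_i minus \<open>d2\<close>; the last is a difference of two
  values of the first form.\<close>

lemma form_differences:
  "al1 + be1 * c1 = p1 + r1 * m1 - d2" "al2 + be2 * c2 = p2 + r2 * m2 - d2"
  "(d1 - d2) * p0 / d1 + (- n0 / d1) * c0 = p0 + r0 * m0 - d2"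
  "be1 * (c1 - c2) = r1 * (m1 - m2) - d2"
proof -
  show 1: "al1 + be1 * c1 = p1 + r1 * m1 - d2" using form_identities(1)[of 0 1 0] by simp
  show "al2 + be2 * c2 = p2 + r2 * m2 - d2" using form_identities(2)[of 0 0 1] by simp
  show "(d1 - d2) * p0 / d1 + (- n0 / d1) * c0 = p0 + r0 * m0 - d2"
    using form_identities(3)[of 1 0 0] by simp
  have "al1 + be1 * c2 = p1 + r1 * m2" using form_identities(1)[of 0 0 1] by simp
  then have "(al1 + be1 * c1) - (al1 + be1 * c2) = (p1 + r1 * m1 - d2) - (p1 + r1 * m2)"
    using 1 by simp
  then show "be1 * (c1 - c2) = r1 * (m1 - m2) - d2" by (simp add: algebra_simps)
qed

lemma sum_forms:
  "al1 + al2 = d1 - d2 - (d1 - d2) * p0 / d1"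
  "be1 + be2 = n0 / d1"
  "c1 * al1 + c2 * al2 = - c0 * ((d1 - d2) * p0 / d1)"
  "c1 * be1 + c2 * be2 = c0 * n0 / d1 - d2"
proof -
  have p: "p1 + p2 = d1 - p0" using sum_p by (simp add: algebra_simps)
  have "al1 + al2 = (d1 - d2) * (p1 + p2) / d1"
    by (simp add: al1_def al2_def ring_distribs add_divide_distrib)
  then show "al1 + al2 = d1 - d2 - (d1 - d2) * p0 / d1"
    unfolding p using d1 by (simp add: diff_divide_distrib right_diff_distrib)
  show "be1 + be2 = n0 / d1"
    by (simp add: be1_def be2_def n0_def n1_def n2_def diff_divide_distrib)
  have cp: "c1 * p1 + c2 * p2 = - c0 * p0"
    by (simp add: c0_def c1_def c2_def algebra_simps)
  have "c1 * al1 + c2 * al2 = (d1 - d2) * (c1 * p1 + c2 * p2) / d1"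
    by (simp add: al1_def al2_def ring_distribs add_divide_distrib mult_ac)
  then show "c1 * al1 + c2 * al2 = - c0 * ((d1 - d2) * p0 / d1)"
    unfolding cp by (simp add: mult_ac)
  have "(p0 + p1 + p2) * (m0 * r0 + m1 * r1 + m2 * r2) - (m0 * p0 + m1 * p1 + m2 * p2) * (r0 + r1 + r2)
      = c0 * n0 + c1 * n1 + c2 * n2"
    unfolding n0_def n1_def n2_def c0_def c1_def c2_def by (simp add: algebra_simps)
  then have cn: "c1 * n1 + c2 * n2 = d1 * d2 - c0 * n0"
    unfolding sum_p sum_r sum_mp sum_mr by (simp add: algebra_simps)
  have "c1 * be1 + c2 * be2 = - (c1 * n1 + c2 * n2) / d1"
    by (simp add: be1_def be2_def add_divide_distrib diff_divide_distrib)
  then show "c1 * be1 + c2 * be2 = c0 * n0 / d1 - d2"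
    unfolding cn using d1 by (simp add: diff_divide_distrib)
qed

text \<open>Determinant and trace of $\overline F_\infty + \overline F_1 + \overline F_2$.\<close>
lemma det_zero:
  "(1 - d1 + (al1 + al2)) * (1 + (c1 * be1 + c2 * be2)) - (be1 + be2) * (c1 * al1 + c2 * al2)
     = (1 - d2) * (1 - p0 - m0 * r0)"
  "(1 - d1 + (al1 + al2)) + (1 + (c1 * be1 + c2 * be2)) = (1 - d2) + (1 - p0 - m0 * r0)"
proof -
  \<comment> \<open>In these terms the matrix at x = 0 is (1 - d2) I minus the rank-one matrix (1,
    c0)^T (a, b). Its eigenvalues are therefore 1 - d2 and 1 - d2 - (a + b c0), and the third form
    identity evaluates the latter.\<close>
  define a b where "a = (d1 - d2) * p0 / d1" and "b = - n0 / d1"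
  have ab: "a + b * c0 = p0 + r0 * m0 - d2"
    using form_differences(3) by (simp add: a_def b_def)
  have sums: "al1 + al2 = d1 - d2 - a" "be1 + be2 = - b" "c1 * al1 + c2 * al2 = - c0 * a"
    "c1 * be1 + c2 * be2 = - c0 * b - d2"
    unfolding sum_forms by (simp_all add: a_def b_def)
  have "(1 - d1 + (d1 - d2 - a)) * (1 + (- c0 * b - d2)) - (- b) * (- c0 * a)
      = (1 - d2) * (1 - d2 - (a + b * c0))"
    by (simp add: algebra_simps)
  then show "(1 - d1 + (al1 + al2)) * (1 + (c1 * be1 + c2 * be2)) - (be1 + be2) * (c1 * al1 + c2 * al2)
     = (1 - d2) * (1 - p0 - m0 * r0)"
    unfolding sums ab by (simp add: algebra_simps)
  have "(1 - d1 + (d1 - d2 - a)) + (1 + (- c0 * b - d2)) = 2 - 2 * d2 - (a + b * c0)"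
    by (simp add: algebra_simps)
  then show "(1 - d1 + (al1 + al2)) + (1 + (c1 * be1 + c2 * be2)) = (1 - d2) + (1 - p0 - m0 * r0)"
    unfolding sums ab by (simp add: algebra_simps)
qed

text \<open>The left side is the determinant of B_infinity + B_1 + B_2 = I - B_0, which is 1 - tr
  B_0 since B_0 is singular.\<close>

lemma det_zero_B:
  "(1 - d1 + (p1 + p2)) * (1 - d2 + (m1 * r1 + m2 * r2)) - (r1 + r2) * (m1 * p1 + m2 * p2)
     = 1 - p0 - m0 * r0"
proof -
  have "p1 + p2 = d1 - p0" "m1 * r1 + m2 * r2 = d2 - m0 * r0" "r1 + r2 = - r0"
    "m1 * p1 + m2 * p2 = - (m0 * p0)"
    using sum_p sum_r sum_mp sum_mr by (simp_all add: algebra_simps eq_neg_iff_add_eq_0)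
  then show ?thesis by (simp only:) (simp add: algebra_simps)
qed

text \<open>After division by (x - x1)(x - x2) two quadratics remain to be compared, the one of B
  and the convolved one. Passing to the latter divides the leading coefficient by 1 - d2, keeps the
  linear one and multiplies the constant one by 1 - d2, so the zeros are scaled by 1 - d2.\<close>

lemma det_g:
  "g11 x * g22 x - g12 x * g21 x
     = (x - x1) * (x - x2) * ((1 - d1) * (x - (1 - d2) * a3) * (x - (1 - d2) * a4))"
proof -
  define D where "D = (1 - d1) * (1 - d2)"
  define mB1 where "mB1 = (1 - d1) * (m1 * r1) + (1 - d2) * p1"
  define mB2 where "mB2 = (1 - d1) * (m2 * r2) + (1 - d2) * p2"
  define MB where "MB = (m2 - m1) * (p1 * r2 - p2 * r1)"
  define mN1 where "mN1 = (1 - d1) * (c1 * be1) + al1"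
  define mN2 where "mN2 = (1 - d1) * (c2 * be2) + al2"
  define MN where "MN = (c2 - c1) * (al1 * be2 - al2 * be1)"
  have B: "D * ((x - x1) * (x - x2)) - x1 * (x - x2) * mB1 - x2 * (x - x1) * mB2 + x1 * x2 * MB
      = D * (x - a3) * (x - a4)" for x
    using det_B[of x] by (simp only: D_def mB1_def mB2_def MB_def)
  have B0: "x1 * x2 * (D + mB1 + mB2 + MB) = D * a3 * a4"
    using B[of 0] by (simp add: algebra_simps)
  have B1: "(x1 + x2) * D + x1 * mB1 + x2 * mB2 = D * (a3 + a4)"
  proof -
    have "(x1 + x2) * D + x1 * mB1 + x2 * mB2 = D + x1 * x2 * (D + mB1 + mB2 + MB)
        - (D * ((1 - x1) * (1 - x2)) - x1 * (1 - x2) * mB1 - x2 * (1 - x1) * mB2 + x1 * x2 * MB)"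
      by (simp add: algebra_simps)
    also have "\<dots> = D * (a3 + a4)"
      unfolding B0 B[of 1] by (simp add: algebra_simps)
    finally show ?thesis .
  qed
  \<comment> \<open>Both mixed determinants drop by the same constant, which offsets the changed
    leading coefficient in the linear term.\<close>
  have mN: "mN1 = mB1 - (1 - d1) * d2" "mN2 = mB2 - (1 - d1) * d2"
  proof -
    have al: "d1 * al1 = (d1 - d2) * p1" "d1 * al2 = (d1 - d2) * p2"
      using d1 by (simp_all add: al1_def al2_def)
    have "mN1 - mB1 + (1 - d1) * d2
        = (1 - d1) * ((al1 + be1 * c1) - (p1 + r1 * m1 - d2)) + (d1 * al1 - (d1 - d2) * p1)"
      by (simp add: mN1_def mB1_def algebra_simps)
    then show "mN1 = mB1 - (1 - d1) * d2"
      unfolding form_differences al by (simp add: algebra_simps add_eq_0_iff)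
    have "mN2 - mB2 + (1 - d1) * d2
        = (1 - d1) * ((al2 + be2 * c2) - (p2 + r2 * m2 - d2)) + (d1 * al2 - (d1 - d2) * p2)"
      by (simp add: mN2_def mB2_def algebra_simps)
    then show "mN2 = mB2 - (1 - d1) * d2"
      unfolding form_differences al by (simp add: algebra_simps add_eq_0_iff)
  qed
  \<comment> \<open>The two sides come from the determinants at x = 0 of the convolved system and of
    B.\<close>
  have const: "1 - d1 + mN1 + mN2 + MN = (1 - d2) * (D + mB1 + mB2 + MB)"
  proof -
    have "1 - d1 + mN1 + mN2 + MN = (1 - d1 + (al1 + al2)) * (1 + (c1 * be1 + c2 * be2))
        - (be1 + be2) * (c1 * al1 + c2 * al2)"
      by (simp add: mN1_def mN2_def MN_def algebra_simps)
    moreover have "D + mB1 + mB2 + MB = (1 - d1 + (p1 + p2)) * (1 - d2 + (m1 * r1 + m2 * r2))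
        - (r1 + r2) * (m1 * p1 + m2 * p2)"
      by (simp add: D_def mB1_def mB2_def MB_def algebra_simps)
    ultimately show ?thesis unfolding det_zero det_zero_B by simp
  qed
  have "g11 x * g22 x - g12 x * g21 x = (x - x1) * (x - x2) *
     ((1 - d1) * ((x - x1) * (x - x2)) - x1 * (x - x2) * mN1 - x2 * (x - x1) * mN2 + x1 * x2 * MN)"
    by (simp add: g11_def g12_def g21_def g22_def mN1_def mN2_def MN_def algebra_simps)
  also have "(1 - d1) * ((x - x1) * (x - x2)) - x1 * (x - x2) * mN1 - x2 * (x - x1) * mN2 + x1 * x2 * MN
     = (1 - d1) * x^2 - ((x1 + x2) * (1 - d1) + x1 * mN1 + x2 * mN2) * x
        + x1 * x2 * (1 - d1 + mN1 + mN2 + MN)"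
    by (simp add: algebra_simps power2_eq_square)
  also have "(x1 + x2) * (1 - d1) + x1 * mN1 + x2 * mN2 = (x1 + x2) * D + x1 * mB1 + x2 * mB2"
    unfolding mN D_def by (simp add: algebra_simps)
  also have "x1 * x2 * (1 - d1 + mN1 + mN2 + MN) = (1 - d2) * (x1 * x2 * (D + mB1 + mB2 + MB))"
    unfolding const by (simp add: mult_ac)
  finally show ?thesis
    unfolding B0 B1 by (simp add: D_def algebra_simps power2_eq_square)
qed

lemma V_mult: "V \<noteq> 0 \<Longrightarrow> V * (x - yt) = V * x - x1 * x2 * (m1 - m2)"
  by (subst right_diff_distrib) (simp add: yt_def)

text \<open>Inserting the \<open>r\<close> equations into m . r = d2 gives \<open>s\<close> times
  the very linear polynomial whose zero is \<open>yt\<close>, now at the old zero y. This links the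
  old zero to the new one.\<close>

lemma d2_eq: "V \<noteq> 0 \<Longrightarrow> d2 = s * V * (y - yt)"
proof -
  assume "V \<noteq> 0"
  then have "s * V * (y - yt) = s * (V * y - x1 * x2 * (m1 - m2))"
    using V_mult by (simp add: mult.assoc)
  also have "\<dots> = m0 * r0 + m1 * r1 + m2 * r2"
    by (simp add: V_def r0_eq r1_eq r2_eq algebra_simps)
  finally show ?thesis by (simp add: sum_mr)
qed

lemma g12_eq: "V \<noteq> 0 \<Longrightarrow> g12 x = V / d1 * (x - yt)"
proof -
  assume "V \<noteq> 0"
  then have "V * (x - yt) = V * x - x1 * x2 * (m1 - m2)" by (rule V_mult)
  moreover have "d1 * be1 = - n1" "d1 * be2 = - n2" using d1 by (simp_all add: be1_def be2_def)
  then have "d1 * g12 x = x1 * (x - x2) * n1 + x2 * (x - x1) * n2"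
  proof -
    have "d1 * g12 x = - x1 * (x - x2) * (d1 * be1) - x2 * (x - x1) * (d1 * be2)"
      by (simp add: g12_def algebra_simps)
    with \<open>d1 * be1 = - n1\<close> \<open>d1 * be2 = - n2\<close> show ?thesis by simp
  qed
  moreover have "x1 * (x - x2) * n1 + x2 * (x - x1) * n2 = V * x - x1 * x2 * (m1 - m2)"
    by (simp add: n1_def n2_def V_def algebra_simps)
  ultimately have "g12 x * d1 = V * (x - yt)" by (simp only: mult.commute[of _ d1])
  then show ?thesis using d1 by (simp add: eq_divide_eq)
qed

text \<open>
  The factor \<open>1 - y * s * V\<close> is the lower right entry of $B(y)$: it coincides with that of the
  convolved system at \<open>yt\<close>.
\<close>
lemma g22_yt:
  assumes V: "V \<noteq> 0"
  shows "g22 yt = (yt - x1) * (yt - x2) * (1 - y * s * V)"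
proof -
  \<comment> \<open>As \<open>g12\<close> vanishes at \<open>yt\<close>, the contributions of the
    two poles to \<open>g22\<close> combine into one with the factor \<open>be1 * (c1 - c2)\<close>,
    which is known.\<close>
  have zero: "x1 * (yt - x2) * be1 = - x2 * (yt - x1) * be2"
    using g12_eq[OF V, of yt] by (simp add: g12_def eq_neg_iff_add_eq_0 algebra_simps)
  have "g22 yt = (yt - x1) * (yt - x2) - c1 * (x1 * (yt - x2) * be1) - x2 * (yt - x1) * (c2 * be2)"
    by (simp add: g22_def mult_ac)
  also have "x2 * (yt - x1) * (c2 * be2) = - c2 * (x1 * (yt - x2) * be1)"
    unfolding zero by simp
  also have "(yt - x1) * (yt - x2) - c1 * (x1 * (yt - x2) * be1) - - c2 * (x1 * (yt - x2) * be1)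
      = (yt - x1) * (yt - x2) - x1 * (yt - x2) * (be1 * (c1 - c2))"
    by (simp add: algebra_simps)
  also have "be1 * (c1 - c2) = r1 * (m1 - m2) - d2" by (rule form_differences)
  also have "x1 * (yt - x2) * (r1 * (m1 - m2) - d2)
      = (yt - x2) * (s * (y - x1) * (x1 * x2 * (m1 - m2)) - x1 * d2)"
    by (simp add: r1_eq algebra_simps)
  also have "x1 * x2 * (m1 - m2) = V * yt" using V by (simp add: yt_def)
  also have "s * (y - x1) * (V * yt) - x1 * d2 = (yt - x1) * (y * s * V)"
    unfolding d2_eq[OF V] by (simp add: algebra_simps)
  finally show ?thesis by (simp add: algebra_simps)
qed

end

section \<open>From the parameters to the residues\<close>

lemma quadratic_zero:
  fixes a b :: complex
  assumes "\<And>x. x \<noteq> a \<Longrightarrow> x \<noteq> b \<Longrightarrow> c0 + c1 * x + c2 * x^2 = 0"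
  shows "c0 = 0" "c1 = 0" "c2 = 0"
proof -
  have "- {a, b} \<subseteq> {x. poly [:c0, c1, c2:] x = 0}"
    using assms by (auto simp: power2_eq_square algebra_simps)
  moreover have "infinite (- {a, b})" by (simp add: infinite_UNIV_char_0)
  ultimately have "[:c0, c1, c2:] = 0"
    using poly_roots_finite finite_subset by blast
  then show "c0 = 0" "c1 = 0" "c2 = 0" by simp_all
qed

lemma smul_nth [simp]: "(c \<odot> M) $ i $ j = c * M $ i $ j"
  by (simp add: smul_def)

text \<open>
  The new zero is $\widetilde y = y \cdot$ \<open>y_num p / y_den p\<close>; the denominators are cleared in order
  that \<open>nondegenerate\<close> consists of polynomial conditions.
\<close>

definition y_den :: "(par \<Rightarrow> complex) \<Rightarrow> complex" where
  "y_den p = p T * p A1 * p A2 * p Chi1 * p Chi2 * (p Y - p A3) * (p Y - p A4) * p Q * p Z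
            - p Th1 * ((p Y - p T * p A1) * (p Y - p T * p A2))"

definition y_num :: "(par \<Rightarrow> complex) \<Rightarrow> complex" where
  "y_num p = p T * p A1 * p A2 * p Chi1 * p Chi2 * (p Y - p A3) * (p Y - p A4) * p Q * p Z
            - p Chi2 * p T * p A1 * p A2 * ((p Y - p T * p A1) * (p Y - p T * p A2))"

text \<open>Given the earlier conditions, those on \<open>y_den\<close> and \<open>y_num\<close>
  mean b \<noteq> 1 and b \<noteq> rho; the last four keep the new zero away from t a_1, t a_2 and
  from rho a_3, rho a_4.\<close>

definition nondegenerate :: "(par \<Rightarrow> complex) \<Rightarrow> bool" where
  "nondegenerate p \<longleftrightarrow> p A1 - p A2 \<noteq> 0 \<and> p Chi1 - p Chi2 \<noteq> 0 \<and>
     p Th1 - p Chi1 * p T * p A1 * p A2 \<noteq> 0 \<and> p Th1 - p Chi2 * p T * p A1 * p A2 \<noteq> 0 \<and>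
     p Y - p T * p A1 \<noteq> 0 \<and> p Y - p T * p A2 \<noteq> 0 \<and> p Y - p A3 \<noteq> 0 \<and> p Y - p A4 \<noteq> 0 \<and>
     y_den p \<noteq> 0 \<and> y_num p \<noteq> 0 \<and>
     p Y * y_num p - p T * p A1 * y_den p \<noteq> 0 \<and> p Y * y_num p - p T * p A2 * y_den p \<noteq> 0 \<and>
     p Th1 * p Y * y_num p - p Chi2 * p T * p A1 * p A2 * p A3 * y_den p \<noteq> 0 \<and>
     p Th1 * p Y * y_num p - p Chi2 * p T * p A1 * p A2 * p A4 * y_den p \<noteq> 0"

locale lax_parameters =
  fixes p :: "par \<Rightarrow> complex"
  assumes adm: "admissible p" and nondeg: "nondegenerate p"
begin

definition "x1 = p T * p A1"
definition "x2 = p T * p A2"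
definition "c = p T * p A1 * p A2 / p Th1"
definition "rho = p Chi2 * c"
definition "ee = (p Y - p A3) * (p Y - p A4) / ((p Y - x1) * (p Y - x2))"
text \<open>The lower right entry of B(y): as a_12(y) = 0, it follows from det A(y) and the
  prescribed a_11(y).\<close>

definition "b = c * p Chi1 * p Chi2 * ee * (p Q * p Z)"
definition "y' = (b - rho) / (b - 1) * p Y"
definition "g' = ee * ((y' - x1) * (y' - x2) / ((y' - rho * p A3) * (y' - rho * p A4))) * (p Q * p Z)"

lemma nonzero [simp]: "p i \<noteq> 0"
  using adm by (simp add: admissible_def)

lemma constraint: "p Chi1 * p Chi2 * p A1 * p A2 * p A3 * p A4 = p Th1 * p Th2"
  using adm by (simp add: admissible_def)

lemma basic_nonzero [simp]:
  "x1 \<noteq> 0" "x2 \<noteq> 0" "c \<noteq> 0" "rho \<noteq> 0" "x1 - x2 \<noteq> 0" "p Y - x1 \<noteq> 0" "p Y - x2 \<noteq> 0"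
  "p Y - p A3 \<noteq> 0" "p Y - p A4 \<noteq> 0" "p Chi1 - p Chi2 \<noteq> 0" "ee \<noteq> 0" "b \<noteq> 0"
proof -
  show "x1 \<noteq> 0" "x2 \<noteq> 0" "c \<noteq> 0" "rho \<noteq> 0" by (simp_all add: x1_def x2_def c_def rho_def)
  show *: "x1 - x2 \<noteq> 0" "p Y - x1 \<noteq> 0" "p Y - x2 \<noteq> 0"
    "p Y - p A3 \<noteq> 0" "p Y - p A4 \<noteq> 0" "p Chi1 - p Chi2 \<noteq> 0"
    using nondeg by (simp_all add: nondegenerate_def x1_def x2_def)
  then show "ee \<noteq> 0" unfolding ee_def divide_eq_0_iff mult_eq_0_iff by blast
  with \<open>c \<noteq> 0\<close> show "b \<noteq> 0" by (simp add: b_def)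
qed

lemmas basic_neq [simp] = basic_nonzero[unfolded right_minus_eq]

lemma rho_neq_1: "rho - 1 \<noteq> 0" and c_Chi1_neq_1: "c * p Chi1 - 1 \<noteq> 0"
proof -
  have "p Th1 * (rho - 1) = - (p Th1 - p Chi2 * p T * p A1 * p A2)"
    "p Th1 * (c * p Chi1 - 1) = - (p Th1 - p Chi1 * p T * p A1 * p A2)"
    by (simp_all add: rho_def c_def right_diff_distrib)
  then show "rho - 1 \<noteq> 0" "c * p Chi1 - 1 \<noteq> 0"
    using nondeg unfolding nondegenerate_def by (metis mult_zero_right neg_equal_0_iff_equal)+
qed

lemma y_den_num_eq: "y_den p = p Th1 * ((p Y - x1) * (p Y - x2)) * (b - 1)"
  "y_num p = p Th1 * ((p Y - x1) * (p Y - x2)) * (b - rho)"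
proof -
  have "p Th1 * ((p Y - x1) * (p Y - x2)) * b
      = p T * p A1 * p A2 * p Chi1 * p Chi2 * (p Y - p A3) * (p Y - p A4) * p Q * p Z"
    by (simp add: b_def ee_def c_def)
  moreover have "p Th1 * ((p Y - x1) * (p Y - x2)) * rho
      = p Chi2 * p T * p A1 * p A2 * ((p Y - x1) * (p Y - x2))"
    by (simp add: rho_def c_def)
  ultimately show "y_den p = p Th1 * ((p Y - x1) * (p Y - x2)) * (b - 1)"
    "y_num p = p Th1 * ((p Y - x1) * (p Y - x2)) * (b - rho)"
    by (simp_all add: y_den_def y_num_def x1_def[symmetric] x2_def[symmetric] right_diff_distrib)
qed

lemma b_neq [simp]: "b - 1 \<noteq> 0" "b - rho \<noteq> 0"
  using nondeg y_den_num_eq by (auto simp: nondegenerate_def)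

lemmas b_neq' [simp] = b_neq[unfolded right_minus_eq]

lemma y'_neq_iff: "y' - u \<noteq> 0 \<longleftrightarrow> p Y * y_num p - u * y_den p \<noteq> 0"
proof -
  have "p Y * y_num p - u * y_den p = p Th1 * ((p Y - x1) * (p Y - x2)) * (b - 1) * (y' - u)"
  proof -
    have "(b - 1) * y' = (b - rho) * p Y" by (simp add: y'_def)
    then have "(b - 1) * (y' - u) = (b - rho) * p Y - u * (b - 1)"
      by (simp add: right_diff_distrib[of "b - 1"] mult.commute[of u])
    then show ?thesis
      unfolding y_den_num_eq mult.assoc[of _ "b - 1"] by (simp only:) (simp add: algebra_simps)
  qed
  then show ?thesis by simp
qed

lemma y'_neq [simp]: "y' \<noteq> 0" "y' - x1 \<noteq> 0" "y' - x2 \<noteq> 0" "y' - rho * p A3 \<noteq> 0" "y' - rho * p A4 \<noteq> 0"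
proof -
  show "y' \<noteq> 0" by (simp add: y'_def)
  show "y' - x1 \<noteq> 0" "y' - x2 \<noteq> 0"
    using nondeg unfolding y'_neq_iff by (simp_all add: nondegenerate_def x1_def x2_def)
  have "p Th1 * (p Y * y_num p - rho * u * y_den p)
      = p Th1 * p Y * y_num p - p Chi2 * p T * p A1 * p A2 * u * y_den p" for u
    by (simp add: rho_def c_def right_diff_distrib)
  then show "y' - rho * p A3 \<noteq> 0" "y' - rho * p A4 \<noteq> 0"
    using nondeg unfolding y'_neq_iff nondegenerate_def by (metis mult_zero_right)+
qed

lemmas y'_neq' [simp] = y'_neq[unfolded right_minus_eq]

lemma g'_nonzero [simp]: "g' \<noteq> 0"
  by (simp add: g'_def)

lemma fuchsian_nth:
  assumes "x \<noteq> x1" "x \<noteq> x2"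
  shows "(x - x1) * (x - x2) * fuchsian p Minf M1 M2 x $ i $ j
     = (x - x1) * (x - x2) * Minf $ i $ j - x1 * (x - x2) * M1 $ i $ j - x2 * (x - x1) * M2 $ i $ j"
proof -
  have "1 / (1 - x / x1) = - x1 / (x - x1)" "1 / (1 - x / x2) = - x2 / (x - x2)"
    using assms by (simp_all add: divide_simps) (simp_all add: algebra_simps)
  then have "fuchsian p Minf M1 M2 x $ i $ j
     = Minf $ i $ j + - x1 / (x - x1) * M1 $ i $ j + - x2 / (x - x2) * M2 $ i $ j"
    by (simp add: fuchsian_def x1_def[symmetric] x2_def[symmetric])
  moreover have "x - x1 \<noteq> 0" "x - x2 \<noteq> 0" using assms by simp_all
  ultimately show ?thesis
    by (simp add: right_diff_distrib[of "(x - x1) * (x - x2)"])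
qed

text \<open>Clearing denominators leaves a quadratic polynomial in each entry which vanishes off two
  points, hence identically; a matrix identity in x thus becomes three coefficient
  equations.\<close>

lemma fuchsian_iff:
  "(\<forall>x. x \<noteq> x1 \<longrightarrow> x \<noteq> x2 \<longrightarrow> (c / ((x - x1) * (x - x2))) \<odot> (C0 + x \<odot> C1 + x^2 \<odot> C2) = fuchsian p Minf M1 M2 x)
   \<longleftrightarrow> (\<forall>i j. c * C0 $ i $ j = x1 * x2 * (Minf $ i $ j + M1 $ i $ j + M2 $ i $ j) \<and>
        c * C1 $ i $ j = - (x1 + x2) * Minf $ i $ j - x1 * M1 $ i $ j - x2 * M2 $ i $ j \<and>
        c * C2 $ i $ j = Minf $ i $ j)"
    (is "?L \<longleftrightarrow> ?R")
proof -
  define k0 where "k0 i j = c * C0 $ i $ j - x1 * x2 * (Minf $ i $ j + M1 $ i $ j + M2 $ i $ j)" for i j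
  define k1 where "k1 i j = c * C1 $ i $ j - (- (x1 + x2) * Minf $ i $ j - x1 * M1 $ i $ j - x2 * M2 $ i $ j)" for i j
  define k2 where "k2 i j = c * C2 $ i $ j - Minf $ i $ j" for i j
  have entry: "((c / ((x - x1) * (x - x2))) \<odot> (C0 + x \<odot> C1 + x^2 \<odot> C2)) $ i $ j = fuchsian p Minf M1 M2 x $ i $ j
      \<longleftrightarrow> k0 i j + k1 i j * x + k2 i j * x^2 = 0" if "x \<noteq> x1" "x \<noteq> x2" for x i j
  proof -
    have q: "(x - x1) * (x - x2) \<noteq> 0" using that by simp
    then have "((c / ((x - x1) * (x - x2))) \<odot> (C0 + x \<odot> C1 + x^2 \<odot> C2)) $ i $ j = fuchsian p Minf M1 M2 x $ i $ j
      \<longleftrightarrow> c * (C0 $ i $ j + x * C1 $ i $ j + x^2 * C2 $ i $ j)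
        = (x - x1) * (x - x2) * fuchsian p Minf M1 M2 x $ i $ j"
      by (simp add: field_simps)
    then show ?thesis unfolding fuchsian_nth[OF that]
      by (simp add: k0_def k1_def k2_def algebra_simps power2_eq_square)
  qed
  show ?thesis
  proof
    assume L: ?L
    have "k0 i j = 0 \<and> k1 i j = 0 \<and> k2 i j = 0" for i j
      using quadratic_zero[of x1 x2 "k0 i j" "k1 i j" "k2 i j"] L entry by metis
    then show ?R by (simp add: k0_def k1_def k2_def)
  next
    assume ?R
    then have "k0 i j = 0" "k1 i j = 0" "k2 i j = 0" for i j
      by (simp_all add: k0_def k1_def k2_def)
    then show ?L using entry by (simp add: vec_eq_iff)
  qed
qed

lemma lax_matrix_coefficients:
  assumes "lax_matrix p A"
  obtains C0 C1 where "A = (\<lambda>x. C0 + x \<odot> C1 + x^2 \<odot> diag2 (p Chi1) (p Chi2))"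
    "C0 $ 1 $ 2 = - p Chi2 * p W * p Y" "C1 $ 1 $ 2 = p Chi2 * p W"
    "C0 $ 1 $ 1 + C0 $ 2 $ 2 = p T * (p Th1 + p Th2)"
    "C0 $ 1 $ 1 * C0 $ 2 $ 2 - C0 $ 1 $ 2 * C0 $ 2 $ 1 = p T^2 * p Th1 * p Th2"
proof -
  obtain C0 C1 C2 where A: "\<And>x. A x = C0 + x \<odot> C1 + x^2 \<odot> C2" and C2: "C2 = diag2 (p Chi1) (p Chi2)"
    and eig: "eigenvalues2 C0 (p T * p Th1) (p T * p Th2)"
    and a12: "\<And>x. A x $ 1 $ 2 = p Chi2 * p W * (x - p Y)"
    using assms unfolding lax_matrix_def by blast
  have C012: "C0 $ 1 $ 2 = - p Chi2 * p W * p Y"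
    using a12[of 0] by (simp add: A C2)
  have C112: "C1 $ 1 $ 2 = p Chi2 * p W"
    using a12[of 1] C012 by (simp add: A C2 algebra_simps)
  have eig': "(x - C0 $ 1 $ 1) * (x - C0 $ 2 $ 2) - C0 $ 1 $ 2 * C0 $ 2 $ 1
      = (x - p T * p Th1) * (x - p T * p Th2)" for x
    using eig unfolding eigenvalues2_def by (simp add: det_2)
  have det0: "C0 $ 1 $ 1 * C0 $ 2 $ 2 - C0 $ 1 $ 2 * C0 $ 2 $ 1 = p T^2 * p Th1 * p Th2"
    using eig'[of 0] by (simp add: power2_eq_square mult_ac)
  have "C0 $ 1 $ 1 + C0 $ 2 $ 2 = p T * (p Th1 + p Th2)"
    using eig'[of 1] eig'[of 0] by (simp add: algebra_simps)
  with A C2 C012 C112 det0 show ?thesis by (intro that[of C0 C1]) auto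
qed

lemma residues_of_lax_matrix:
  assumes lax: "lax_matrix p A"
    and fuchs: "\<forall>x. x \<noteq> x1 \<longrightarrow> x \<noteq> x2 \<longrightarrow> (c / ((x - x1) * (x - x2))) \<odot> A x = fuchsian p Binf B1 B2 x"
  obtains m0 m1 m2 p0 p1 p2 r0 r1 r2 s where
    "mat 1 - Binf - B1 - B2 = rank_one m0 p0 r0" "B1 = rank_one m1 p1 r1" "B2 = rank_one m2 p2 r2"
    "lax_residues m0 m1 m2 p0 p1 p2 r0 r1 r2 (1 - c * p Chi1) (1 - rho) x1 x2 (p Y) s (p A3) (p A4)"
    "1 - p0 - m0 * r0 = p Th2 / p Th1"
    "1 - p Y * s * (m0 * (x1 - x2) + m1 * x2 - m2 * x1) = b"
proof -
  obtain C0 C1 where A: "A = (\<lambda>x. C0 + x \<odot> C1 + x^2 \<odot> diag2 (p Chi1) (p Chi2))"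
    and C012: "C0 $ 1 $ 2 = - p Chi2 * p W * p Y" and C112: "C1 $ 1 $ 2 = p Chi2 * p W"
    and tr0: "C0 $ 1 $ 1 + C0 $ 2 $ 2 = p T * (p Th1 + p Th2)"
    and det0: "C0 $ 1 $ 1 * C0 $ 2 $ 2 - C0 $ 1 $ 2 * C0 $ 2 $ 1 = p T^2 * p Th1 * p Th2"
    using lax by (rule lax_matrix_coefficients)
  have detA: "det (A x) = p Chi1 * p Chi2 * ((x - x1) * (x - x2)) * ((x - p A3) * (x - p A4))"
    and a12: "A x $ 1 $ 2 = p Chi2 * p W * (x - p Y)"
    and a11: "A (p Y) $ 1 $ 1 = (p Y - x1) * (p Y - x2) / (p Q * p Z)" for x
    using lax by (simp_all add: lax_matrix_def x1_def x2_def mult.assoc)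
  have coeff: "c * C0 $ i $ j = x1 * x2 * (Binf $ i $ j + B1 $ i $ j + B2 $ i $ j)"
    "c * C1 $ i $ j = - (x1 + x2) * Binf $ i $ j - x1 * B1 $ i $ j - x2 * B2 $ i $ j"
    "Binf $ i $ j = c * diag2 (p Chi1) (p Chi2) $ i $ j" for i j
    using fuchs unfolding A fuchsian_iff by simp_all
  have Binf: "Binf $ 1 $ 1 = c * p Chi1" "Binf $ 1 $ 2 = 0" "Binf $ 2 $ 1 = 0" "Binf $ 2 $ 2 = rho"
    by (simp_all add: coeff(3) rho_def)
  have bA: "c * A x $ i $ j
      = (x - x1) * (x - x2) * Binf $ i $ j - x1 * (x - x2) * B1 $ i $ j - x2 * (x - x1) * B2 $ i $ j" for x i j
  proof -
    have "c * A x $ i $ j = c * C0 $ i $ j + x * (c * C1 $ i $ j) + x^2 * Binf $ i $ j"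
      by (simp add: A coeff(3) algebra_simps)
    then show ?thesis unfolding coeff(1,2) by (simp add: algebra_simps power2_eq_square)
  qed
  define B0 where "B0 = mat 1 - Binf - B1 - B2"
  \<comment> \<open>Chosen such that c a_12(x) = s x1 x2 (x1 - x2) (x - y), the normalization of
    \<open>lax_residues\<close>.\<close>
  define s where "s = c * p Chi2 * p W / (x1 * x2 * (x1 - x2))"
  have s: "s \<noteq> 0" by (simp add: s_def)
  have cw: "c * p Chi2 * p W = s * (x1 * x2 * (x1 - x2))" by (simp add: s_def)
  have cA12: "c * A x $ 1 $ 2 = s * (x1 * x2 * (x1 - x2)) * (x - p Y)" for x
    by (simp add: a12 flip: cw)
  have r1_val: "B1 $ 1 $ 2 = s * x2 * (p Y - x1)"
  proof -
    have "x1 * (x1 - x2) * B1 $ 1 $ 2 = x1 * (x1 - x2) * (s * x2 * (p Y - x1))"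
      using bA[of x1 1 2] unfolding cA12 by (simp add: algebra_simps)
    then show ?thesis by simp
  qed
  have r2_val: "B2 $ 1 $ 2 = - s * x1 * (p Y - x2)"
  proof -
    have "x2 * (x2 - x1) * B2 $ 1 $ 2 = x2 * (x2 - x1) * (- s * x1 * (p Y - x2))"
      using bA[of x2 1 2] unfolding cA12 by (simp add: algebra_simps)
    moreover have "x2 * (x2 - x1) \<noteq> 0" using basic_nonzero(2,5) by (metis mult_eq_0_iff right_minus_eq)
    ultimately show ?thesis by (metis mult_cancel_left)
  qed
  have r0_val: "B0 $ 1 $ 2 = s * (x1 - x2) * p Y"
    by (simp add: B0_def Binf r1_val r2_val algebra_simps)
  have dets: "B1 $ 1 $ 1 * B1 $ 2 $ 2 = B1 $ 1 $ 2 * B1 $ 2 $ 1"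
    "B2 $ 1 $ 1 * B2 $ 2 $ 2 = B2 $ 1 $ 2 * B2 $ 2 $ 1"
    "B0 $ 1 $ 1 * B0 $ 2 $ 2 = B0 $ 1 $ 2 * B0 $ 2 $ 1"
  proof -
    have cdet: "(c * A x $ 1 $ 1) * (c * A x $ 2 $ 2) - (c * A x $ 1 $ 2) * (c * A x $ 2 $ 1) = c^2 * det (A x)" for x
      by (simp add: det_2 algebra_simps power2_eq_square)
    have "c * A x1 $ i $ j = - (x1 * (x1 - x2)) * B1 $ i $ j" for i j by (simp add: bA)
    with cdet[of x1] have "(x1 * (x1 - x2))^2 * (B1 $ 1 $ 1 * B1 $ 2 $ 2 - B1 $ 1 $ 2 * B1 $ 2 $ 1) = 0"
      by (simp add: detA algebra_simps power2_eq_square)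
    then show "B1 $ 1 $ 1 * B1 $ 2 $ 2 = B1 $ 1 $ 2 * B1 $ 2 $ 1" by simp
    have "c * A x2 $ i $ j = - (x2 * (x2 - x1)) * B2 $ i $ j" for i j by (simp add: bA)
    with cdet[of x2] have "(x2 * (x2 - x1))^2 * (B2 $ 1 $ 1 * B2 $ 2 $ 2 - B2 $ 1 $ 2 * B2 $ 2 $ 1) = 0"
      by (simp add: detA algebra_simps power2_eq_square)
    moreover have "x2 - x1 \<noteq> 0" using basic_nonzero(5) by (metis right_minus_eq)
    ultimately show "B2 $ 1 $ 1 * B2 $ 2 $ 2 = B2 $ 1 $ 2 * B2 $ 2 $ 1" by simp
    \<comment> \<open>B(0) = A_0 / (t theta_1), so B_0 = I - A_0 / (t theta_1) is singular because t
      theta_1 is an eigenvalue of A_0.\<close>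
    have B0: "p T * p Th1 * B0 $ i $ j = p T * p Th1 * (mat 1 :: complex^2^2) $ i $ j - C0 $ i $ j" for i j
    proof -
      have "x1 * x2 * B0 $ i $ j = x1 * x2 * (mat 1 :: complex^2^2) $ i $ j - c * C0 $ i $ j"
        by (simp add: B0_def coeff(1) algebra_simps)
      moreover have "x1 * x2 = c * (p T * p Th1)" by (simp add: x1_def x2_def c_def)
      ultimately have "c * (p T * p Th1 * B0 $ i $ j)
          = c * (p T * p Th1 * (mat 1 :: complex^2^2) $ i $ j - C0 $ i $ j)"
        by (simp add: algebra_simps)
      then show ?thesis by simp
    qed
    define k where "k = p T * p Th1"
    have k: "k \<noteq> 0" by (simp add: k_def)
    have "k^2 * (B0 $ 1 $ 1 * B0 $ 2 $ 2 - B0 $ 1 $ 2 * B0 $ 2 $ 1)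
        = (k * B0 $ 1 $ 1) * (k * B0 $ 2 $ 2) - (k * B0 $ 1 $ 2) * (k * B0 $ 2 $ 1)"
      by (simp add: algebra_simps power2_eq_square)
    also have "\<dots> = k^2 - k * (C0 $ 1 $ 1 + C0 $ 2 $ 2) + (C0 $ 1 $ 1 * C0 $ 2 $ 2 - C0 $ 1 $ 2 * C0 $ 2 $ 1)"
      unfolding B0[folded k_def] by (simp add: algebra_simps power2_eq_square)
    also have "\<dots> = 0" unfolding tr0 det0 k_def by (simp add: algebra_simps power2_eq_square)
    finally show "B0 $ 1 $ 1 * B0 $ 2 $ 2 = B0 $ 1 $ 2 * B0 $ 2 $ 1" using k by simp
  qed
  have r_nonzero: "B0 $ 1 $ 2 \<noteq> 0" "B1 $ 1 $ 2 \<noteq> 0" "B2 $ 1 $ 2 \<noteq> 0"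
    using s by (simp_all add: r0_val r1_val r2_val)
  \<comment> \<open>The slope is read off the second column, which needs a nonzero upper right
    entry; the vanishing determinant supplies the remaining entry.\<close>
  have rank: "B = rank_one (B $ 2 $ 2 / B $ 1 $ 2) (B $ 1 $ 1) (B $ 1 $ 2)"
    if "B $ 1 $ 1 * B $ 2 $ 2 = B $ 1 $ 2 * B $ 2 $ 1" "B $ 1 $ 2 \<noteq> 0" for B :: "complex^2^2"
    using that by (simp add: vec_eq_iff forall_2 field_simps)
  define m0 m1 m2 where "m0 = B0 $ 2 $ 2 / B0 $ 1 $ 2" and "m1 = B1 $ 2 $ 2 / B1 $ 1 $ 2"
    and "m2 = B2 $ 2 $ 2 / B2 $ 1 $ 2"
  define p0 p1 p2 where "p0 = B0 $ 1 $ 1" and "p1 = B1 $ 1 $ 1" and "p2 = B2 $ 1 $ 1"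
  define r0 r1 r2 where "r0 = B0 $ 1 $ 2" and "r1 = B1 $ 1 $ 2" and "r2 = B2 $ 1 $ 2"
  have B0r: "B0 = rank_one m0 p0 r0" and B1r: "B1 = rank_one m1 p1 r1" and B2r: "B2 = rank_one m2 p2 r2"
    unfolding m0_def m1_def m2_def p0_def p1_def p2_def r0_def r1_def r2_def
    using rank dets r_nonzero by blast+
  have sum: "B0 $ i $ j + B1 $ i $ j + B2 $ i $ j = (mat 1 :: complex^2^2) $ i $ j - Binf $ i $ j" for i j
    by (simp add: B0_def)
  have rank_one_res: "rank_one_residues m0 m1 m2 p0 p1 p2 r0 r1 r2 (1 - c * p Chi1) (1 - rho)"
  proof
    show "p0 + p1 + p2 = 1 - c * p Chi1" using sum[of 1 1] by (simp add: p0_def p1_def p2_def Binf)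
    show "r0 + r1 + r2 = 0" using sum[of 1 2] by (simp add: r0_def r1_def r2_def Binf)
    show "m0 * p0 + m1 * p1 + m2 * p2 = 0" using sum[of 2 1] by (simp add: B0r B1r B2r Binf)
    show "m0 * r0 + m1 * r1 + m2 * r2 = 1 - rho" using sum[of 2 2] by (simp add: B0r B1r B2r Binf)
    show "1 - c * p Chi1 \<noteq> 0" "1 - rho \<noteq> 0" using c_Chi1_neq_1 rho_neq_1 by simp_all
    show "1 - c * p Chi1 \<noteq> 1 - rho" by (simp add: rho_def)
    show "r0 \<noteq> 0" "r1 \<noteq> 0" "r2 \<noteq> 0" using r_nonzero by (simp_all add: r0_def r1_def r2_def)
  qed
  then interpret rank_one_residues m0 m1 m2 p0 p1 p2 r0 r1 r2 "1 - c * p Chi1" "1 - rho" .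
  define D where "D = c * p Chi1 * rho"
  define e1 where "e1 = (c * p Chi1) * (m1 * r1) + rho * p1"
  define e2 where "e2 = (c * p Chi1) * (m2 * r2) + rho * p2"
  define e3 where "e3 = (m2 - m1) * (p1 * r2 - p2 * r1)"
  define R where "R x = D * ((x - x1) * (x - x2)) - x1 * (x - x2) * e1 - x2 * (x - x1) * e2 + x1 * x2 * e3" for x
  have detB: "(x - x1) * (x - x2) * R x = (x - x1) * (x - x2) * (D * (x - p A3) * (x - p A4))" for x
  proof -
    have "(c * A x $ 1 $ 1) * (c * A x $ 2 $ 2) - (c * A x $ 1 $ 2) * (c * A x $ 2 $ 1) = c^2 * det (A x)"
      by (simp add: det_2 algebra_simps power2_eq_square)
    moreover have "(c * A x $ 1 $ 1) * (c * A x $ 2 $ 2) - (c * A x $ 1 $ 2) * (c * A x $ 2 $ 1)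
       = (x - x1) * (x - x2) * R x"
      unfolding bA Binf B1r B2r rank_one_nth R_def D_def e1_def e2_def e3_def
      by (simp add: algebra_simps)
    ultimately have "(x - x1) * (x - x2) * R x = c^2 * det (A x)" by simp
    then show ?thesis unfolding detA by (simp only: D_def rho_def power2_eq_square mult_ac)
  qed
  \<comment> \<open>The factor (x - x1)(x - x2) cancels only away from its zeros; comparing
    quadratics extends the identity to them.\<close>
  have R: "R x = D * (x - p A3) * (x - p A4)" for x
  proof -
    have *: "R x - D * (x - p A3) * (x - p A4)
        = (x1 * x2 * (D + e1 + e2 + e3) - D * p A3 * p A4)
          + (D * (p A3 + p A4) - D * (x1 + x2) - x1 * e1 - x2 * e2) * x + 0 * x^2" for x
      by (simp add: R_def algebra_simps power2_eq_square)
    have zero: "(x1 * x2 * (D + e1 + e2 + e3) - D * p A3 * p A4)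
          + (D * (p A3 + p A4) - D * (x1 + x2) - x1 * e1 - x2 * e2) * x + 0 * x^2 = 0"
      if "x \<noteq> x1" "x \<noteq> x2" for x
      unfolding *[symmetric] using detB[of x] that by simp
    have "R x - D * (x - p A3) * (x - p A4) = 0"
      unfolding * using quadratic_zero[OF zero] by simp
    then show ?thesis by simp
  qed
  have res: "lax_residues m0 m1 m2 p0 p1 p2 r0 r1 r2 (1 - c * p Chi1) (1 - rho) x1 x2 (p Y) s (p A3) (p A4)"
  proof
    show "(1 - (1 - c * p Chi1)) * (1 - (1 - rho)) * ((x - x1) * (x - x2))
        - x1 * (x - x2) * ((1 - (1 - c * p Chi1)) * (m1 * r1) + (1 - (1 - rho)) * p1)
        - x2 * (x - x1) * ((1 - (1 - c * p Chi1)) * (m2 * r2) + (1 - (1 - rho)) * p2)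
        + x1 * x2 * ((m2 - m1) * (p1 * r2 - p2 * r1))
        = (1 - (1 - c * p Chi1)) * (1 - (1 - rho)) * (x - p A3) * (x - p A4)" for x
      using R[of x] by (simp add: R_def D_def e1_def e2_def e3_def)
  qed (simp_all add: r0_def r1_def r2_def r0_val r1_val r2_val)
  have trace: "1 - p0 - m0 * r0 = p Th2 / p Th1"
  proof -
    have "p0 + m0 * r0 = B0 $ 1 $ 1 + B0 $ 2 $ 2" by (simp add: B0r)
    then have "x1 * x2 * (p0 + m0 * r0) = 2 * (x1 * x2) - c * (C0 $ 1 $ 1 + C0 $ 2 $ 2)"
      by (simp add: B0_def distrib_left[of c] coeff(1)) (simp add: algebra_simps)
    moreover have "x1 * x2 = c * (p T * p Th1)" by (simp add: x1_def x2_def c_def)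
    ultimately have "c * p T * (p Th1 * (p0 + m0 * r0)) = c * p T * (p Th1 - p Th2)"
      unfolding tr0 by (simp add: algebra_simps)
    then have "p Th1 * (p0 + m0 * r0) = p Th1 - p Th2" by simp
    then show ?thesis by (simp add: field_simps)
  qed
  have value_b: "1 - p Y * s * (m0 * (x1 - x2) + m1 * x2 - m2 * x1) = b"
  proof -
    let ?q = "(p Y - x1) * (p Y - x2)"
    have "A (p Y) $ 1 $ 1 * A (p Y) $ 2 $ 2 = p Chi1 * p Chi2 * ?q * ((p Y - p A3) * (p Y - p A4))"
      using detA[of "p Y"] by (simp add: det_2 a12)
    then have "?q * A (p Y) $ 2 $ 2
        = ?q * (p Chi1 * p Chi2 * ((p Y - p A3) * (p Y - p A4)) * (p Q * p Z))"
      unfolding a11 by (simp add: divide_eq_eq mult_ac)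
    moreover have "?q \<noteq> 0" by simp
    ultimately have "A (p Y) $ 2 $ 2 = p Chi1 * p Chi2 * ((p Y - p A3) * (p Y - p A4)) * (p Q * p Z)"
      by (metis mult_cancel_left)
    then have "c * A (p Y) $ 2 $ 2 = ?q * b" by (simp add: b_def ee_def)
    moreover have "c * A (p Y) $ 2 $ 2 = ?q * rho - x1 * (p Y - x2) * (m1 * r1) - x2 * (p Y - x1) * (m2 * r2)"
      unfolding bA Binf by (simp add: B1r B2r)
    moreover have "?q * rho - x1 * (p Y - x2) * (m1 * r1) - x2 * (p Y - x1) * (m2 * r2)
        = ?q * (1 - p Y * s * (m0 * (x1 - x2) + m1 * x2 - m2 * x1))"
    proof -
      have r: "r0 = s * (x1 - x2) * p Y" "r1 = s * x2 * (p Y - x1)" "r2 = - s * x1 * (p Y - x2)"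
        by (simp_all only: r0_def r1_def r2_def r0_val r1_val r2_val)
      have "rho = 1 - (m0 * r0 + m1 * r1 + m2 * r2)" unfolding sum_mr by simp
      then have rho: "rho = 1 - (m0 * (s * (x1 - x2) * p Y) + m1 * (s * x2 * (p Y - x1))
          + m2 * (- s * x1 * (p Y - x2)))" by (simp only: r)
      show ?thesis unfolding r by (subst rho) (simp add: algebra_simps)
    qed
    ultimately show ?thesis by simp
  qed
  show ?thesis using that[OF B0r[unfolded B0_def] B1r B2r res trace value_b] .
qed

section \<open>Existence of the linear system and of its convolution\<close>

lemma exists_lax_matrix: "\<exists>A. lax_matrix p A"
proof -
  define y where "y = p Y"
  \<comment> \<open>\<open>u\<close> and \<open>v\<close> are the values at y of the diagonal
    entries, \<open>S\<close> is the trace of A(0), and \<open>s3\<close> is the coefficient of x^3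
    in det A(x).\<close>
  define u where "u = (y - x1) * (y - x2) / (p Q * p Z)"
  define v where "v = p Chi1 * p Chi2 * ((y - p A3) * (y - p A4)) * (p Q * p Z)"
  define S where "S = p T * (p Th1 + p Th2)"
  define s3 where "s3 = - p Chi1 * p Chi2 * (x1 + x2 + p A3 + p A4)"
  \<comment> \<open>\<open>tau\<close> is the sum of the linear coefficients \<open>al\<close>,
    \<open>ga\<close> of the diagonal entries, from the trace at y. The x^3 coefficient of the
    determinant then separates them, as chi_1 and chi_2 differ.\<close>
  define tau where "tau = (u + v - (p Chi1 + p Chi2) * y^2 - S) / y"
  define ga where "ga = (s3 - p Chi2 * tau) / (p Chi1 - p Chi2)"
  define al where "al = tau - ga"
  define be where "be = u - p Chi1 * y^2 - al * y"
  define de where "de = v - p Chi2 * y^2 - ga * y"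
  define e where "e x = p Chi1 * p Chi2 * (x - x1) * (x - x2) * (x - p A3) * (x - p A4)" for x
  define e2 where "e2 = p Chi1 * p Chi2 * (x1 * x2 + (x1 + x2) * (p A3 + p A4) + p A3 * p A4)"
  define e1 where "e1 = - p Chi1 * p Chi2 * (x1 * x2 * (p A3 + p A4) + (x1 + x2) * p A3 * p A4)"
  define e0 where "e0 = p Chi1 * p Chi2 * x1 * x2 * p A3 * p A4"
  define h2 where "h2 = p Chi1 * de + al * ga + p Chi2 * be - e2"
  define h1 where "h1 = al * de + be * ga - e1"
  define h0 where "h0 = be * de - e0"
  have y: "y \<noteq> 0" by (simp add: y_def)
  have e: "e x = p Chi1 * p Chi2 * x^4 + s3 * x^3 + e2 * x^2 + e1 * x + e0" for x
    unfolding e_def s3_def e2_def e1_def e0_def by (simp add: algebra_simps eval_nat_numeral)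
  have al_ga: "p Chi1 * ga + p Chi2 * al = s3"
  proof -
    have "(p Chi1 - p Chi2) * ga = s3 - p Chi2 * tau" by (simp add: ga_def)
    then show ?thesis by (simp add: al_def algebra_simps)
  qed
  have a11_y: "p Chi1 * y^2 + al * y + be = u" and a22_y: "p Chi2 * y^2 + ga * y + de = v"
    by (simp_all add: be_def de_def)
  have be_de: "be + de = S"
  proof -
    have "be + de = u + v - (p Chi1 + p Chi2) * y^2 - tau * y"
      by (simp add: be_def de_def al_def algebra_simps)
    then show ?thesis using y by (simp add: tau_def)
  qed
  have uv: "u * v = e y"
    by (simp add: u_def v_def e_def)
  have prod: "(p Chi1 * x^2 + al * x + be) * (p Chi2 * x^2 + ga * x + de)
      = e x + (h2 * x^2 + h1 * x + h0)" for x
  proof -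
    have "(p Chi1 * x^2 + al * x + be) * (p Chi2 * x^2 + ga * x + de)
      = p Chi1 * p Chi2 * x^4 + (p Chi1 * ga + p Chi2 * al) * x^3 + (h2 + e2) * x^2 + (h1 + e1) * x + (h0 + e0)"
      unfolding h2_def h1_def h0_def by (simp add: algebra_simps eval_nat_numeral)
    then show ?thesis unfolding al_ga e by (simp add: algebra_simps)
  qed
  \<comment> \<open>The product of the diagonal entries exceeds det A by a polynomial of degree at
    most 2 which vanishes at y, hence is divisible by the upper right entry; the quotient is the
    lower left entry.\<close>
  have h: "h2 * y^2 + h1 * y + h0 = 0"
    using prod[of y] unfolding a11_y a22_y uv by simp
  then have quot: "h2 * x^2 + h1 * x + h0 = (x - y) * (h2 * x + (h2 * y + h1))" for x
    by (simp add: algebra_simps power2_eq_square eq_neg_iff_add_eq_0)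
  let ?w = "p Chi2 * p W"
  define C0 :: "complex^2^2" where "C0 = vector [vector [be, - ?w * y], vector [(h2 * y + h1) / ?w, de]]"
  define C1 :: "complex^2^2" where "C1 = vector [vector [al, ?w], vector [h2 / ?w, ga]]"
  define A where "A x = C0 + x \<odot> C1 + x^2 \<odot> diag2 (p Chi1) (p Chi2)" for x
  have A_nth: "A x $ 1 $ 1 = p Chi1 * x^2 + al * x + be" "A x $ 1 $ 2 = ?w * (x - y)"
    "A x $ 2 $ 1 = (h2 * x + (h2 * y + h1)) / ?w" "A x $ 2 $ 2 = p Chi2 * x^2 + ga * x + de" for x
    by (simp_all add: A_def C0_def C1_def vector_2 algebra_simps add_divide_distrib)
  have detA: "det (A x) = e x" for x
  proof -
    have "det (A x) = e x + (h2 * x^2 + h1 * x + h0) - (x - y) * (h2 * x + (h2 * y + h1))"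
      unfolding det_2 A_nth prod by simp
    then show ?thesis unfolding quot by simp
  qed
  have "det C0 = e0"
  proof -
    have "A 0 = C0" by (simp add: A_def vec_eq_iff)
    then show ?thesis using detA[of 0] unfolding e by simp
  qed
  moreover have "e0 = (p T * p Th1) * (p T * p Th2)"
    using constraint by (simp add: e0_def x1_def x2_def) (simp add: mult_ac)
  ultimately have "eigenvalues2 C0 (p T * p Th1) (p T * p Th2)"
  proof -
    assume C0: "det C0 = e0" and e0: "e0 = (p T * p Th1) * (p T * p Th2)"
    have "det (mat x - C0) = x^2 - (C0 $ 1 $ 1 + C0 $ 2 $ 2) * x + det C0" for x
      by (simp add: det_2 algebra_simps power2_eq_square)
    then have "det (mat x - C0) = x^2 - (be + de) * x + det C0" for x
      by (simp add: C0_def vector_2)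
    then show ?thesis unfolding eigenvalues2_def C0 e0 be_de S_def
      by (simp add: algebra_simps power2_eq_square)
  qed
  then have "lax_matrix p A"
    unfolding lax_matrix_def x1_def[symmetric] x2_def[symmetric] y_def[symmetric]
    using A_def detA[unfolded e_def] A_nth(2) A_nth(1)[of y, unfolded a11_y, unfolded u_def]
    by blast
  then show ?thesis by blast
qed

text \<open>The form \<open>1 - (1 - c * p Chi1)\<close> matches \<open>1 - d1\<close> of the
  residue locale.\<close>

lemma middle_convolution_unfold:
  "middle_convolution p A Ginf G1 G2 \<longleftrightarrow>
     (\<exists>Binf B0 B1 B2 e.
        (\<forall>x. x \<noteq> x1 \<longrightarrow> x \<noteq> x2 \<longrightarrow> (c / ((x - x1) * (x - x2))) \<odot> A x = fuchsian p Binf B1 B2 x) \<and>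
        B0 = mat 1 - Binf - B1 - B2 \<and>
        (let F1 = block_matrix (vector
                    [vector [0, 0, 0], vector [B0, B1 - mat (1 - rho), B2], vector [0, 0, 0]]);
             F2 = block_matrix (vector
                    [vector [0, 0, 0], vector [0, 0, 0], vector [B0, B1, B2 - mat (1 - rho)]]);
             Fhat = block_matrix (vector
                    [vector [B0, B1, B2], vector [B0, B1, B2], vector [B0, B1, B2]]);
             Finf = mat 1 - Fhat;
             K = {v. B0 *v block v 1 = 0 \<and> B1 *v block v 2 = 0 \<and> B2 *v block v 3 = 0};
             L = {v. (Fhat - mat (1 - rho)) *v v = 0};
             S = {u + v | u v. u \<in> K \<and> v \<in> L}
         in quotient_basis S e \<and>
            induces S e Finf Ginf \<and> induces S e F1 G1 \<and> induces S e F2 G2 \<and>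
            Ginf = diag2 (1 - (1 - c * p Chi1)) 1))"
proof -
  have "p Chi2 * p T * p A1 * p A2 / p Th1 = rho" "p Chi1 * p T * p A1 * p A2 / p Th1 = 1 - (1 - c * p Chi1)"
    "p T * p A1 * p A2 / p Th1 = c"
    by (simp_all add: rho_def c_def)
  then show ?thesis
    unfolding middle_convolution_def x1_def[symmetric] x2_def[symmetric] Let_def by (simp only:)
qed

lemma exists_fuchsian:
  assumes "lax_matrix p A"
  obtains Binf B1 B2 where
    "\<forall>x. x \<noteq> x1 \<longrightarrow> x \<noteq> x2 \<longrightarrow> (c / ((x - x1) * (x - x2))) \<odot> A x = fuchsian p Binf B1 B2 x"
proof -
  obtain C0 C1 where A: "A = (\<lambda>x. C0 + x \<odot> C1 + x^2 \<odot> diag2 (p Chi1) (p Chi2))"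
    using assms by (rule lax_matrix_coefficients)
  let ?D = "diag2 (p Chi1) (p Chi2)"
  \<comment> \<open>Residues of c A(x) / ((x - x1)(x - x2)), adapted to the denominators 1 - x /
    x_i.\<close>
  define B1 where "B1 = (- c / (x1 * (x1 - x2))) \<odot> (C0 + x1 \<odot> C1 + x1^2 \<odot> ?D)"
  define B2 where "B2 = (c / (x2 * (x1 - x2))) \<odot> (C0 + x2 \<odot> C1 + x2^2 \<odot> ?D)"
  have B: "x1 * B1 $ i $ j = - c * (C0 $ i $ j + x1 * C1 $ i $ j + x1^2 * ?D $ i $ j) / (x1 - x2)"
    "x2 * B2 $ i $ j = c * (C0 $ i $ j + x2 * C1 $ i $ j + x2^2 * ?D $ i $ j) / (x1 - x2)" for i j
    by (simp_all add: B1_def B2_def)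
  have coeffs: "c * a0 = x1 * x2 * (c * a2 + b1 + b2)"
    "c * a1 = - (x1 + x2) * (c * a2) - x1 * b1 - x2 * b2"
    if "x1 * b1 = - c * (a0 + x1 * a1 + x1^2 * a2) / (x1 - x2)"
      "x2 * b2 = c * (a0 + x2 * a1 + x2^2 * a2) / (x1 - x2)" for a0 a1 a2 b1 b2
  proof -
    have eq: "(x1 - x2) * (x1 * b1) = - c * (a0 + x1 * a1 + x1^2 * a2)"
      "(x1 - x2) * (x2 * b2) = c * (a0 + x2 * a1 + x2^2 * a2)"
      using that by simp_all
    have "(x1 - x2) * (x1 * x2 * (c * a2 + b1 + b2))
        = (x1 - x2) * (x1 * x2 * (c * a2)) + x2 * ((x1 - x2) * (x1 * b1)) + x1 * ((x1 - x2) * (x2 * b2))"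
      by (simp add: algebra_simps)
    also have "\<dots> = (x1 - x2) * (c * a0)"
      unfolding eq by (simp add: algebra_simps power2_eq_square)
    finally show "c * a0 = x1 * x2 * (c * a2 + b1 + b2)" by simp
    have "(x1 - x2) * (- (x1 + x2) * (c * a2) - x1 * b1 - x2 * b2)
        = (x1 - x2) * (- (x1 + x2) * (c * a2)) - (x1 - x2) * (x1 * b1) - (x1 - x2) * (x2 * b2)"
      by (simp add: algebra_simps)
    also have "\<dots> = (x1 - x2) * (c * a1)"
      unfolding eq by (simp add: algebra_simps power2_eq_square)
    finally show "c * a1 = - (x1 + x2) * (c * a2) - x1 * b1 - x2 * b2" by simp
  qed
  have "\<forall>x. x \<noteq> x1 \<longrightarrow> x \<noteq> x2 \<longrightarrow> (c / ((x - x1) * (x - x2))) \<odot> A x = fuchsian p (c \<odot> ?D) B1 B2 x"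
    unfolding A fuchsian_iff smul_nth using coeffs[OF B] by blast
  then show ?thesis by (rule that)
qed

lemma exists_middle_convolution:
  assumes "lax_matrix p A"
  shows "\<exists>Ginf G1 G2. middle_convolution p A Ginf G1 G2"
proof -
  obtain Binf B1 B2 where fuchs:
    "\<forall>x. x \<noteq> x1 \<longrightarrow> x \<noteq> x2 \<longrightarrow> (c / ((x - x1) * (x - x2))) \<odot> A x = fuchsian p Binf B1 B2 x"
    using assms by (rule exists_fuchsian)
  obtain m0 m1 m2 p0 p1 p2 r0 r1 r2 s where
    B: "mat 1 - Binf - B1 - B2 = rank_one m0 p0 r0" "B1 = rank_one m1 p1 r1" "B2 = rank_one m2 p2 r2"
    and "lax_residues m0 m1 m2 p0 p1 p2 r0 r1 r2 (1 - c * p Chi1) (1 - rho) x1 x2 (p Y) s (p A3) (p A4)"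
    using assms fuchs by (rule residues_of_lax_matrix)
  then interpret R: lax_residues m0 m1 m2 p0 p1 p2 r0 r1 r2 "1 - c * p Chi1" "1 - rho" x1 x2 "p Y" s "p A3" "p A4"
    by simp
  obtain e G1 G2 where "quotient_basis R.S e"
    "induces R.S e (mat 1 - R.Fhat) (diag2 (1 - (1 - c * p Chi1)) 1)"
    "induces R.S e R.F1 G1" "induces R.S e R.F2 G2"
    using R.exists_diagonalizing_basis by blast
  note basis = this[unfolded R.F1_def R.F2_def R.K_def R.L_def, unfolded R.Fhat_def, folded B]
  have "middle_convolution p A (diag2 (1 - (1 - c * p Chi1)) 1) G1 G2"
    unfolding middle_convolution_unfold Let_def by (intro exI conjI) (rule fuchs refl basis)+
  then show ?thesis by blast
qed

text \<open>The labels of the two theta eigenvalues are exchanged to agree with the images of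
  \<open>\<nu>5\<close> and \<open>\<nu>6\<close>. The argument \<open>w\<close> stays free because
  it depends on the chosen basis.\<close>

definition transformed :: "complex \<Rightarrow> par \<Rightarrow> complex" where
  "transformed w = p(Chi1 := rho * p Chi1, A3 := rho * p A3, A4 := rho * p A4,
     Th1 := rho * p Th2, Th2 := rho^2 * p Th1, W := w, Y := y', Z := g' / p Q)"

lemma admissible_transformed: "w \<noteq> 0 \<Longrightarrow> admissible (transformed w)"
proof -
  assume w: "w \<noteq> 0"
  have "transformed w i \<noteq> 0" for i
    using w by (cases i) (simp_all add: transformed_def)
  moreover have "rho * p Chi1 * p Chi2 * p A1 * p A2 * (rho * p A3) * (rho * p A4)
      = rho^3 * (p Chi1 * p Chi2 * p A1 * p A2 * p A3 * p A4)"
    by (simp add: eval_nat_numeral)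
  then have "rho * p Chi1 * p Chi2 * p A1 * p A2 * (rho * p A3) * (rho * p A4) = rho * p Th2 * (rho^2 * p Th1)"
    unfolding constraint by (simp add: eval_nat_numeral)
  ultimately show ?thesis by (simp add: admissible_def transformed_def)
qed

text \<open>The factor chi_2 makes the leading coefficients chi_2 c chi_1 = rho chi_1 and
  chi_2.\<close>

lemma lax_matrix_transformed:
  assumes lax: "lax_matrix p A" and mc: "middle_convolution p A Ginf G1 G2"
  shows "\<exists>At w. (\<forall>x. x \<noteq> x1 \<longrightarrow> x \<noteq> x2 \<longrightarrow>
      At x = (p Chi2 * (x - x1) * (x - x2)) \<odot> fuchsian p Ginf G1 G2 x) \<and>
    w \<noteq> 0 \<and> lax_matrix (transformed w) At"
proof -
  obtain Binf B0 B1 B2 e where fuchs: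
      "\<forall>x. x \<noteq> x1 \<longrightarrow> x \<noteq> x2 \<longrightarrow> (c / ((x - x1) * (x - x2))) \<odot> A x = fuchsian p Binf B1 B2 x"
    and B0: "B0 = mat 1 - Binf - B1 - B2"
    and conv: "let F1 = block_matrix (vector
                    [vector [0, 0, 0], vector [B0, B1 - mat (1 - rho), B2], vector [0, 0, 0]]);
             F2 = block_matrix (vector
                    [vector [0, 0, 0], vector [0, 0, 0], vector [B0, B1, B2 - mat (1 - rho)]]);
             Fhat = block_matrix (vector
                    [vector [B0, B1, B2], vector [B0, B1, B2], vector [B0, B1, B2]]);
             Finf = mat 1 - Fhat;
             K = {v. B0 *v block v 1 = 0 \<and> B1 *v block v 2 = 0 \<and> B2 *v block v 3 = 0};
             L = {v. (Fhat - mat (1 - rho)) *v v = 0};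
             S = {u + v | u v. u \<in> K \<and> v \<in> L}
         in quotient_basis S e \<and>
            induces S e Finf Ginf \<and> induces S e F1 G1 \<and> induces S e F2 G2 \<and>
            Ginf = diag2 (1 - (1 - c * p Chi1)) 1"
    using mc unfolding middle_convolution_unfold by blast
  obtain m0 m1 m2 p0 p1 p2 r0 r1 r2 s where
    B: "B0 = rank_one m0 p0 r0" "B1 = rank_one m1 p1 r1" "B2 = rank_one m2 p2 r2"
    and res: "lax_residues m0 m1 m2 p0 p1 p2 r0 r1 r2 (1 - c * p Chi1) (1 - rho) x1 x2 (p Y) s (p A3) (p A4)"
    and tr: "1 - p0 - m0 * r0 = p Th2 / p Th1"
    and b: "1 - p Y * s * (m0 * (x1 - x2) + m1 * x2 - m2 * x1) = b"
    using lax fuchs unfolding B0 by (rule residues_of_lax_matrix)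
  from res interpret R: lax_residues m0 m1 m2 p0 p1 p2 r0 r1 r2 "1 - c * p Chi1" "1 - rho" x1 x2 "p Y" s "p A3" "p A4" .
  have Ginf: "Ginf = diag2 (1 - (1 - c * p Chi1)) 1" using conv by (simp only: Let_def)
  have ind: "quotient_basis R.S e" "induces R.S e (mat 1 - R.Fhat) (diag2 (1 - (1 - c * p Chi1)) 1)"
    "induces R.S e R.F1 G1" "induces R.S e R.F2 G2"
    using conv unfolding R.F1_def R.F2_def R.K_def R.L_def unfolding R.Fhat_def unfolding B Let_def Ginf by (simp_all only:)
  obtain k where k: "k \<noteq> 0"
    and G1: "G1 $ 1 $ 1 = R.al1" "G1 $ 1 $ 2 = k * R.be1" "G1 $ 2 $ 1 = R.c1 * R.al1 / k" "G1 $ 2 $ 2 = R.c1 * R.be1"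
    and G2: "G2 $ 1 $ 1 = R.al2" "G2 $ 1 $ 2 = k * R.be2" "G2 $ 2 $ 1 = R.c2 * R.al2 / k" "G2 $ 2 $ 2 = R.c2 * R.be2"
    using R.induced_matrices[OF ind] by blast
  have V: "R.V = (1 - b) / (s * p Y)" and s: "s \<noteq> 0"
  proof -
    have sV: "p Y * s * R.V = 1 - b" unfolding b[symmetric] R.V_def by simp
    then show "s \<noteq> 0" using b_neq(1) by auto
    with sV show "R.V = (1 - b) / (s * p Y)" by (simp add: eq_divide_eq mult_ac)
  qed
  have V0: "R.V \<noteq> 0" using s by (simp add: V)
  have yt: "R.yt = y'"
  proof -
    \<comment> \<open>Eliminating \<open>s * R.V\<close> between this equation and the value of
      \<open>b\<close> leaves a linear equation for the new zero.\<close>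
    have "1 - rho = s * R.V * (p Y - R.yt)" by (rule R.d2_eq[OF V0])
    then have "(1 - rho) * p Y = (1 - b) * (p Y - R.yt)" using s by (simp add: V)
    then have "(b - 1) * R.yt = (b - rho) * p Y" by (simp add: algebra_simps)
    then show ?thesis by (simp add: y'_def eq_divide_eq mult.commute)
  qed
  \<comment> \<open>The basis scale \<open>k\<close> is absorbed here.\<close>
  define w where "w = k * R.V / (1 - c * p Chi1)"
  have w: "w \<noteq> 0" using k V0 R.d1 by (simp add: w_def)
  define At :: "complex \<Rightarrow> complex^2^2" where "At x = vector [vector [p Chi2 * R.g11 x, p Chi2 * k * R.g12 x],
    vector [p Chi2 * R.g21 x / k, p Chi2 * R.g22 x]]" for x
  have At_nth: "At x $ 1 $ 1 = p Chi2 * R.g11 x" "At x $ 1 $ 2 = p Chi2 * k * R.g12 x"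
    "At x $ 2 $ 1 = p Chi2 * R.g21 x / k" "At x $ 2 $ 2 = p Chi2 * R.g22 x" for x
    by (simp_all add: At_def vector_2)
  have At: "At x = (p Chi2 * (x - x1) * (x - x2)) \<odot> fuchsian p Ginf G1 G2 x" if "x \<noteq> x1" "x \<noteq> x2" for x
  proof -
    have "(p Chi2 * (x - x1) * (x - x2)) * fuchsian p Ginf G1 G2 x $ i $ j
        = p Chi2 * ((x - x1) * (x - x2) * Ginf $ i $ j - x1 * (x - x2) * G1 $ i $ j - x2 * (x - x1) * G2 $ i $ j)" for i j
      using fuchsian_nth[OF that, of Ginf G1 G2 i j] by (simp add: mult.assoc)
    then show ?thesis
      unfolding vec_eq_iff forall_2 smul_nth
      by (simp only: At_nth Ginf G1 G2 diag2_nth R.g11_def R.g12_def R.g21_def R.g22_def)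
        (simp add: algebra_simps add_divide_distrib diff_divide_distrib)
  qed
  have det: "det (At x) = p Chi2^2 * ((x - x1) * (x - x2) * ((c * p Chi1) * (x - rho * p A3) * (x - rho * p A4)))" for x
  proof -
    have "det (At x) = p Chi2^2 * (R.g11 x * R.g22 x - R.g12 x * R.g21 x)"
      using k by (simp add: det_2 At_nth power2_eq_square right_diff_distrib)
    then show ?thesis unfolding R.det_g by simp
  qed
  define C0 where "C0 = At 0"
  define C1 :: "complex^2^2" where "C1 = vector
    [vector [p Chi2 * (- (x1 + x2) * (c * p Chi1) - x1 * R.al1 - x2 * R.al2), p Chi2 * k * (- x1 * R.be1 - x2 * R.be2)],
     vector [p Chi2 * (- x1 * (R.c1 * R.al1) - x2 * (R.c2 * R.al2)) / k, p Chi2 * (- (x1 + x2) - x1 * (R.c1 * R.be1) - x2 * (R.c2 * R.be2))]]"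
  have quad: "At x = C0 + x \<odot> C1 + x^2 \<odot> diag2 (rho * p Chi1) (p Chi2)" for x
    by (simp add: C0_def C1_def vec_eq_iff forall_2 At_nth vector_2 R.g11_def R.g12_def R.g21_def R.g22_def)
      (simp add: rho_def algebra_simps power2_eq_square add_divide_distrib diff_divide_distrib)
  have eig: "eigenvalues2 C0 (p T * (rho * p Th2)) (p T * (rho^2 * p Th1))"
  proof -
    have x12: "p Chi2 * (x1 * x2) = rho * (p T * p Th1)" by (simp add: rho_def c_def x1_def x2_def)
    have "R.g11 0 + R.g22 0 = x1 * x2 * ((1 - (1 - c * p Chi1) + (R.al1 + R.al2)) + (1 + (R.c1 * R.be1 + R.c2 * R.be2)))"
      by (simp add: R.g11_def R.g22_def algebra_simps)
    then have "C0 $ 1 $ 1 + C0 $ 2 $ 2 = p Chi2 * (x1 * x2) * (rho + p Th2 / p Th1)"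
      unfolding R.det_zero tr by (simp add: C0_def At_nth flip: distrib_left)
    then have tr0: "C0 $ 1 $ 1 + C0 $ 2 $ 2 = p T * (rho^2 * p Th1) + p T * (rho * p Th2)"
      unfolding x12 by (simp add: distrib_left power2_eq_square)
    have "det C0 = p Chi2^2 * (x1 * x2 * ((c * p Chi1) * (rho * p A3) * (rho * p A4)))"
      using det[of 0] by (simp add: C0_def)
    also have "\<dots> = rho^2 * (x1 * x2) * p Chi2 * rho * p Chi1 * p A3 * p A4"
      by (simp add: rho_def power2_eq_square)
    also have "\<dots> = rho^3 * p T^2 * (p Chi1 * p Chi2 * p A1 * p A2 * p A3 * p A4)"
      by (simp add: x1_def x2_def power2_eq_square eval_nat_numeral)
    also have "\<dots> = (p T * (rho * p Th2)) * (p T * (rho^2 * p Th1))"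
      unfolding constraint by (simp add: eval_nat_numeral)
    finally have det0: "det C0 = (p T * (rho * p Th2)) * (p T * (rho^2 * p Th1))" .
    have "det (mat x - C0) = x^2 - (C0 $ 1 $ 1 + C0 $ 2 $ 2) * x + det C0" for x
      by (simp add: det_2 algebra_simps power2_eq_square)
    then show ?thesis
      unfolding eigenvalues2_def tr0 det0 by (simp add: algebra_simps power2_eq_square)
  qed
  have a12: "At x $ 1 $ 2 = p Chi2 * w * (x - y')" for x
    by (simp add: At_nth R.g12_eq[OF V0] yt w_def)
  have a11: "At y' $ 1 $ 1 = (y' - x1) * (y' - x2) / g'"
  proof -
    let ?q = "(y' - x1) * (y' - x2)"
    \<comment> \<open>The lower right entry keeps the value \<open>b\<close>. Since the upper right
      entry vanishes at \<open>y'\<close>, the determinant then yields the upper left entry, and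
      thereby \<open>g'\<close>.\<close>
    have g22: "R.g22 y' = ?q * b"
      using R.g22_yt[OF V0] unfolding yt by (simp add: V s)
    have "At y' $ 1 $ 1 * At y' $ 2 $ 2 = det (At y')"
      by (simp add: det_2 a12)
    then have "At y' $ 1 $ 1 * (p Chi2 * (?q * b))
        = p Chi2^2 * (?q * ((c * p Chi1) * (y' - rho * p A3) * (y' - rho * p A4)))"
      unfolding det At_nth(4) g22 .
    then have "?q * p Chi2 * (At y' $ 1 $ 1 * b)
        = ?q * p Chi2 * (p Chi2 * c * p Chi1 * ((y' - rho * p A3) * (y' - rho * p A4)))"
      by (simp only: power2_eq_square mult_ac)
    moreover have "?q * p Chi2 \<noteq> 0" by simp
    ultimately have "At y' $ 1 $ 1 * b = p Chi2 * c * p Chi1 * ((y' - rho * p A3) * (y' - rho * p A4))"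
      by (metis mult_cancel_left)
    then have "At y' $ 1 $ 1 * (ee * (p Q * p Z)) = (y' - rho * p A3) * (y' - rho * p A4)"
      by (simp add: b_def)
    moreover have "At y' $ 1 $ 1 * g' = At y' $ 1 $ 1 * (ee * (p Q * p Z))
        * (?q / ((y' - rho * p A3) * (y' - rho * p A4)))"
      by (simp add: g'_def)
    ultimately have "At y' $ 1 $ 1 * g' = ?q" by simp
    then show ?thesis by (simp add: eq_divide_eq)
  qed
  have "lax_matrix (transformed w) At"
    unfolding lax_matrix_def
  proof (intro conjI exI allI)
    show "At x = C0 + x \<odot> C1 + x^2 \<odot> diag2 (rho * p Chi1) (p Chi2)" for x by (rule quad)
    show "diag2 (rho * p Chi1) (p Chi2) = diag2 (transformed w Chi1) (transformed w Chi2)"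
      by (simp add: transformed_def)
    show "eigenvalues2 C0 (transformed w T * transformed w Th1) (transformed w T * transformed w Th2)"
      using eig by (simp add: transformed_def)
    show "det (At x) = transformed w Chi1 * transformed w Chi2 * (x - transformed w T * transformed w A1)
        * (x - transformed w T * transformed w A2) * (x - transformed w A3) * (x - transformed w A4)" for x
      unfolding det by (simp add: transformed_def x1_def x2_def rho_def power2_eq_square)
    show "At x $ 1 $ 2 = transformed w Chi2 * transformed w W * (x - transformed w Y)" for x
      by (simp add: a12 transformed_def)
    show "At (transformed w Y) $ 1 $ 1 = (transformed w Y - transformed w T * transformed w A1)
        * (transformed w Y - transformed w T * transformed w A2) / (transformed w Q * transformed w Z)"
      using a11 by (simp add: transformed_def x1_def x2_def)
  qed
  with At w show ?thesis by blast
qed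

end

section \<open>Values of the word at a parameter point\<close>

lemma (in lax_parameters) word_values:
  assumes xi: "change_of_variables p \<xi>"
  shows "\<exists>\<xi>t. (\<forall>v. rat_val id \<xi> (word_W (X v)) (\<xi>t v)) \<and> change_of_variables (transformed w) \<xi>t"
proof -
  have val: "\<xi> VG = p Q * p Z" "\<xi> VF = p Y" "\<xi> N1 = p Chi1" "p Q * \<xi> N2 = p Chi2"
    "\<xi> N3 = p A3" "\<xi> N4 = p A4"
    and quot: "\<xi> N5 / \<xi> K2 = p T * p A1 * p A2 / p Th1" "\<xi> N6 / \<xi> K2 = p T * p A1 * p A2 / p Th2"
      "\<xi> K1 / \<xi> N7 = x1" "\<xi> K1 / \<xi> N8 = x2"
    using xi by (simp_all add: change_of_variables_def x1_def x2_def)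
  \<comment> \<open>Only these quotients are prescribed. As x / 0 = 0, a nonzero quotient forces
    both of its terms to be nonzero.\<close>
  have "\<xi> N5 / \<xi> K2 \<noteq> 0" "\<xi> N6 / \<xi> K2 \<noteq> 0" "\<xi> K1 / \<xi> N7 \<noteq> 0" "\<xi> K1 / \<xi> N8 \<noteq> 0"
    unfolding quot by simp_all
  then have nz: "\<xi> K1 \<noteq> 0" "\<xi> K2 \<noteq> 0" "\<xi> N5 \<noteq> 0" "\<xi> N6 \<noteq> 0" "\<xi> N7 \<noteq> 0" "\<xi> N8 \<noteq> 0"
    by auto
  have nz': "\<xi> N1 \<noteq> 0" "\<xi> N3 \<noteq> 0" "\<xi> N4 \<noteq> 0" by (simp_all add: val)
  note id = field_hom_id
  note intros = rat_val_X[OF id] rat_val_1[OF id] rat_val_mult[OF id] rat_val_divide[OF id]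
    rat_val_diff[OF id] rat_val_power[OF id]
  have rho: "rat_val id \<xi> rho_W rho"
  proof (rule rat_val_eq)
    show "rat_val id \<xi> rho_W (\<xi> K1^2 * \<xi> K2 / (\<xi> N1 * \<xi> N3 * \<xi> N4 * \<xi> N6 * \<xi> N7 * \<xi> N8))"
      unfolding rho_W_def by (intro intros) (use nz nz' in simp)
    have "\<xi> K1^2 * \<xi> K2 / (\<xi> N1 * \<xi> N3 * \<xi> N4 * \<xi> N6 * \<xi> N7 * \<xi> N8)
        = (\<xi> K1 / \<xi> N7) * (\<xi> K1 / \<xi> N8) / (\<xi> N6 / \<xi> K2 * (\<xi> N1 * \<xi> N3 * \<xi> N4))"
      by (simp add: power2_eq_square mult_ac)
    also have "\<dots> = p T * p Th2 / (p Chi1 * p A3 * p A4)"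
      unfolding quot val by (simp add: x1_def x2_def)
    \<comment> \<open>Expanding by theta_1 makes the constraint applicable; it turns the expression
      into chi_2 t a_1 a_2 / theta_1.\<close>
    also have "\<dots> = p T * (p Th1 * p Th2) / (p Th1 * p Chi1 * p A3 * p A4)" by simp
    also have "\<dots> = rho" unfolding constraint[symmetric] by (simp add: rho_def c_def)
    finally show "\<xi> K1^2 * \<xi> K2 / (\<xi> N1 * \<xi> N3 * \<xi> N4 * \<xi> N6 * \<xi> N7 * \<xi> N8) = rho" .
  qed
  have k7: "rat_val id \<xi> (\<kappa>1 / \<nu>7) x1" and k8: "rat_val id \<xi> (\<kappa>1 / \<nu>8) x2"
    unfolding quot[symmetric] using nz by (auto intro: intros)
  have f: "rat_val id \<xi> \<ff> (p Y)" and g: "rat_val id \<xi> \<gg> (p Q * p Z)"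
    and n1: "rat_val id \<xi> \<nu>1 (p Chi1)" and n3: "rat_val id \<xi> \<nu>3 (p A3)" and n4: "rat_val id \<xi> \<nu>4 (p A4)"
    unfolding val[symmetric] by (rule intros)+
  have E: "rat_val id \<xi> E_W ee"
    unfolding E_W_def ee_def by (intro intros f n3 n4 k7 k8) simp
  have b_rho: "ee * (p Q * p Z) = b / (rho * p Chi1)"
    by (simp add: b_def rho_def)
  have fW: "rat_val id \<xi> f_W y'"
  proof (rule rat_val_eq)
    have *: "ee * (p Q * p Z) - 1 / (rho * p Chi1) = (b - 1) / (rho * p Chi1)"
      unfolding b_rho by (simp add: diff_divide_distrib)
    show "rat_val id \<xi> f_W ((ee * (p Q * p Z) - 1 / p Chi1) / (ee * (p Q * p Z) - 1 / (rho * p Chi1)) * p Y)"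
      unfolding f_W_def
    proof (intro intros E g n1 rho f)
      show "ee * (p Q * p Z) - 1 / (rho * p Chi1) \<noteq> 0" unfolding * by simp
    qed simp_all
    have "ee * (p Q * p Z) - 1 / p Chi1 = (b - rho) / (rho * p Chi1)"
      unfolding b_rho by (simp add: diff_divide_distrib)
    then show "(ee * (p Q * p Z) - 1 / p Chi1) / (ee * (p Q * p Z) - 1 / (rho * p Chi1)) * p Y = y'"
      unfolding * by (simp add: y'_def)
  qed
  have gW: "rat_val id \<xi> g_W g'"
    unfolding g_W_def g'_def by (intro intros E fW k7 k8 rho n3 n4 g) simp
  define \<xi>t where "\<xi>t v = (case v of
     K1 \<Rightarrow> rho * \<xi> K1 | K2 \<Rightarrow> rho^2 * \<xi> K2 | N1 \<Rightarrow> rho * \<xi> N1 | N2 \<Rightarrow> \<xi> N2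
   | N3 \<Rightarrow> rho * \<xi> N3 | N4 \<Rightarrow> rho * \<xi> N4 | N5 \<Rightarrow> rho * \<xi> N6 | N6 \<Rightarrow> \<xi> N5
   | N7 \<Rightarrow> rho * \<xi> N7 | N8 \<Rightarrow> rho * \<xi> N8 | VF \<Rightarrow> y' | VG \<Rightarrow> g')" for v
  have "rat_val id \<xi> (word_W (X v)) (\<xi>t v)" for v
    by (cases v) (auto simp: word_W_X \<xi>t_def intro: intros rho fW gW)
  moreover have "change_of_variables (transformed w) \<xi>t"
  proof -
    have "rho * \<xi> N6 / (rho^2 * \<xi> K2) = (\<xi> N6 / \<xi> K2) / rho" "\<xi> N5 / (rho^2 * \<xi> K2) = (\<xi> N5 / \<xi> K2) / rho^2"
      by (simp_all add: power2_eq_square)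
    then have "rho * \<xi> N6 / (rho^2 * \<xi> K2) = p T * p A1 * p A2 / (rho * p Th2)"
      "\<xi> N5 / (rho^2 * \<xi> K2) = p T * p A1 * p A2 / (rho^2 * p Th1)"
      unfolding quot by (simp_all add: mult.commute)
    then show ?thesis
      using quot val by (simp add: change_of_variables_def transformed_def \<xi>t_def x1_def x2_def)
  qed
  ultimately show ?thesis by blast
qed

section \<open>Genericity\<close>

definition polynomial_function :: "(('v \<Rightarrow> complex) \<Rightarrow> complex) \<Rightarrow> bool" where
  "polynomial_function F \<longleftrightarrow> (\<exists>P :: 'v mpoly. \<forall>p. peval id p P = F p)"

lemma polynomial_function_const: "polynomial_function (\<lambda>p. a)"
  unfolding polynomial_function_def
  by (rule exI[of _ "Poly_Mapping.single 0 a"]) (simp add: peval_single[OF field_hom_id])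

lemma polynomial_function_var: "polynomial_function (\<lambda>p. p v)"
  unfolding polynomial_function_def
  by (rule exI[of _ "Poly_Mapping.single (Poly_Mapping.single v 1) 1"])
    (simp add: peval_single[OF field_hom_id])

lemma polynomial_function_add:
  "polynomial_function F \<Longrightarrow> polynomial_function G \<Longrightarrow> polynomial_function (\<lambda>p. F p + G p)"
  unfolding polynomial_function_def by (metis peval_add[OF field_hom_id])

lemma polynomial_function_mult:
  "polynomial_function F \<Longrightarrow> polynomial_function G \<Longrightarrow> polynomial_function (\<lambda>p. F p * G p)"
  unfolding polynomial_function_def by (metis peval_mult[OF field_hom_id])

lemma polynomial_function_diff:
  assumes "polynomial_function F" "polynomial_function G"
  shows "polynomial_function (\<lambda>p. F p - G p)"
  using polynomial_function_add[OF assms(1) polynomial_function_mult[OF polynomial_function_const[of "- 1"] assms(2)]]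
  by simp

lemmas polynomial_function_intros = polynomial_function_const polynomial_function_var
  polynomial_function_add polynomial_function_mult polynomial_function_diff

text \<open>A single polynomial is required because \<open>generically\<close> asks for one;
  conjunctions are handled by products.\<close>

definition open_condition :: "(('v \<Rightarrow> complex) \<Rightarrow> bool) \<Rightarrow> bool" where
  "open_condition R \<longleftrightarrow> (\<exists>F. polynomial_function F \<and> (\<forall>p. R p \<longleftrightarrow> F p \<noteq> 0))"

lemma open_condition_nonzero: "polynomial_function F \<Longrightarrow> open_condition (\<lambda>p. F p \<noteq> 0)"
  unfolding open_condition_def by blast

lemma open_condition_conj:
  assumes "open_condition R" "open_condition S"
  shows "open_condition (\<lambda>p. R p \<and> S p)"
proof -
  obtain F G where "polynomial_function F" "\<And>p. R p \<longleftrightarrow> F p \<noteq> 0"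
    and "polynomial_function G" "\<And>p. S p \<longleftrightarrow> G p \<noteq> 0"
    using assms unfolding open_condition_def by blast
  then show ?thesis
    unfolding open_condition_def by (intro exI[of _ "\<lambda>p. F p * G p"]) (simp add: polynomial_function_mult)
qed

lemma open_condition_nondegenerate: "open_condition nondegenerate"
  unfolding nondegenerate_def[abs_def] y_den_def y_num_def
  by (intro open_condition_conj open_condition_nonzero polynomial_function_intros)

lemma generically_nondegenerate:
  assumes "\<And>p. lax_parameters p \<Longrightarrow> R p"
  shows "generically R"
proof -
  obtain P :: "par mpoly" where P: "\<And>p. nondegenerate p \<longleftrightarrow> peval id p P \<noteq> 0"
    using open_condition_nondegenerate unfolding open_condition_def polynomial_function_def by metis
  \<comment> \<open>An admissible point at which \<open>y_den\<close> is -5 and \<open>y_num\<close>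
    is 4; the signs of A2 and Th2 balance in the constraint.\<close>
  define p :: "par \<Rightarrow> complex" where "p = (\<lambda>_. 1)(Y := 2, A2 := -1, Chi2 := 2, Th2 := -2)"
  have "admissible p" by (simp add: admissible_def p_def)
  moreover have "nondegenerate p"
    by (simp add: nondegenerate_def y_den_def y_num_def p_def)
  ultimately show ?thesis
    unfolding generically_def using P assms by (metis lax_parameters.intro)
qed

theorem proposition4p1:
  defines "word \<equiv> s5 \<circ> s2 \<circ> s1 \<circ> s0 \<circ> s2 \<circ> s3 \<circ> s2 \<circ> s0 \<circ> s1 \<circ> s2"
  defines "E \<equiv> (\<ff> - \<nu>3) * (\<ff> - \<nu>4) / ((\<ff> - \<kappa>1 / \<nu>7) * (\<ff> - \<kappa>1 / \<nu>8))"
  defines "ft \<equiv> (E * \<gg> - 1 / \<nu>1) / (E * \<gg> - \<kappa>2 / (q_W * \<nu>1 * \<nu>2 * \<nu>5)) * \<ff>"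
  defines "gt \<equiv> E * ((ft - \<kappa>1 / \<nu>7) * (ft - \<kappa>1 / \<nu>8) /
                     ((ft - q_W * \<nu>2 * \<nu>3 * \<nu>5 / \<kappa>2) * (ft - q_W * \<nu>2 * \<nu>4 * \<nu>5 / \<kappa>2))) * \<gg>"
  shows
    "generically (\<lambda>p.
       (\<exists>A. lax_matrix p A) \<and>
       (\<forall>A. lax_matrix p A \<longrightarrow>
          (\<exists>Ginf G1 G2. middle_convolution p A Ginf G1 G2) \<and>
          (\<forall>Ginf G1 G2. middle_convolution p A Ginf G1 G2 \<longrightarrow>
             (\<exists>At pt.
                (\<forall>x. x \<noteq> p T * p A1 \<longrightarrow> x \<noteq> p T * p A2 \<longrightarrow>
                   At x = (p Chi2 * (x - p T * p A1) * (x - p T * p A2)) \<odot> fuchsian p Ginf G1 G2 x) \<and>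
                admissible pt \<and> lax_matrix pt At \<and>
                pt Q = p Q \<and> pt T = p T \<and> pt A1 = p A1 \<and> pt A2 = p A2 \<and>
                (\<forall>\<xi>. change_of_variables p \<xi> \<longrightarrow>
                   (\<exists>\<xi>t. (\<forall>v. rat_val id \<xi> (word (X v)) (\<xi>t v)) \<and>
                          change_of_variables pt \<xi>t))))))
     \<and> word \<nu>1 = q_W * (\<nu>1 * \<nu>2 * \<nu>5 / \<kappa>2)
     \<and> word \<nu>2 = \<nu>2
     \<and> word (\<kappa>1 / \<nu>7) = \<kappa>1 / \<nu>7
     \<and> word (\<kappa>1 / \<nu>8) = \<kappa>1 / \<nu>8
     \<and> word \<nu>3 = q_W * (\<nu>2 * \<nu>3 * \<nu>5 / \<kappa>2)
     \<and> word \<nu>4 = q_W * (\<nu>2 * \<nu>4 * \<nu>5 / \<kappa>2)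
     \<and> word (\<kappa>2 / \<nu>5) = q_W * (\<nu>2 * \<nu>5 / \<nu>6)
     \<and> word (\<kappa>2 / \<nu>6) = q_W^2 * (\<nu>2^2 * \<nu>5 / \<kappa>2)
     \<and> word \<ff> = ft
     \<and> word \<gg> = gt"
proof -
  have word: "word = word_W" by (simp add: word_def word_W_def)
  have E: "E = E_W" by (simp add: E_def E_W_def)
  have q: "q_W \<noteq> 0" by (simp add: q_W_def)
  \<comment> \<open>The stated formulas contain q, the computed ones \<open>rho_W\<close>;
    \<open>rho_W_eq\<close> translates between them.\<close>
  have "\<kappa>2 / (q_W * \<nu>1 * \<nu>2 * \<nu>5) = 1 / (rho_W * \<nu>1)"
    using q by (simp add: rho_W_eq)
  then have ft: "ft = f_W" by (simp add: ft_def f_W_def E)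
  have "q_W * \<nu>2 * \<nu>3 * \<nu>5 / \<kappa>2 = rho_W * \<nu>3" "q_W * \<nu>2 * \<nu>4 * \<nu>5 / \<kappa>2 = rho_W * \<nu>4"
    by (simp_all add: rho_W_eq)
  then have gt: "gt = g_W" by (simp add: gt_def g_W_def E ft)
  show ?thesis
    unfolding word ft gt
  proof (intro conjI generically_nondegenerate allI impI)
    fix p assume "lax_parameters p"
    then interpret lax_parameters p .
    show "\<exists>A. lax_matrix p A" by (rule exists_lax_matrix)
    fix A assume lax: "lax_matrix p A"
    show "\<exists>Ginf G1 G2. middle_convolution p A Ginf G1 G2"
      using lax by (rule exists_middle_convolution)
    fix Ginf G1 G2 assume "middle_convolution p A Ginf G1 G2"
    from lax_matrix_transformed[OF lax this] obtain At w where
      At: "\<forall>x. x \<noteq> x1 \<longrightarrow> x \<noteq> x2 \<longrightarrow> At x = (p Chi2 * (x - x1) * (x - x2)) \<odot> fuchsian p Ginf G1 G2 x"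
      and w: "w \<noteq> 0" and lax': "lax_matrix (transformed w) At"
      by blast
    have pt: "transformed w Q = p Q" "transformed w T = p T" "transformed w A1 = p A1" "transformed w A2 = p A2"
      by (simp_all add: transformed_def)
    show "\<exists>At pt.
                (\<forall>x. x \<noteq> p T * p A1 \<longrightarrow> x \<noteq> p T * p A2 \<longrightarrow>
                   At x = (p Chi2 * (x - p T * p A1) * (x - p T * p A2)) \<odot> fuchsian p Ginf G1 G2 x) \<and>
                admissible pt \<and> lax_matrix pt At \<and>
                pt Q = p Q \<and> pt T = p T \<and> pt A1 = p A1 \<and> pt A2 = p A2 \<and>
                (\<forall>\<xi>. change_of_variables p \<xi> \<longrightarrow>
                   (\<exists>\<xi>t. (\<forall>v. rat_val id \<xi> (word_W (X v)) (\<xi>t v)) \<and>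
                          change_of_variables pt \<xi>t))"
      using At admissible_transformed[OF w] lax' pt word_values
      unfolding x1_def x2_def by blast
  next
    show "word_W (\<kappa>2 / \<nu>5) = q_W * (\<nu>2 * \<nu>5 / \<nu>6)" "word_W (\<kappa>2 / \<nu>6) = q_W^2 * (\<nu>2^2 * \<nu>5 / \<kappa>2)"
      by (simp_all add: word_W_X) (simp_all add: rho_W_eq power2_eq_square)
  qed (use q in \<open>simp_all add: word_W_X rho_W_eq\<close>)
qed


end
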